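(* For all $r,q\in\mathbb{N}$ with $r,q\ge 2$ and all $\mu>0$, there exists $C>0$ such that, for every $p=p(n)\in[0,1]$ with $p\ge Cn^{-r+1}$, the random $r$-graph $G\sim\mathbb{G}^{(r)}(n,p)$ satisfies the following with high probability: for any $q$-colouring of the edges of $G$, there exists a monochromatic matching in $G$ of size at least $(1-\mu)\frac{n}{r+q-1}$.
   Context: An $r$-graph is an $r$-uniform hypergraph. $\mathbb{G}^{(r)}(n,p)$ is the binomial random $r$-graph on $n$ vertices, in which each $r$-set of vertices is an edge independently with probability $p$. A $q$-colouring of the edges is an arbitrary assignment of one of $q$ colours to each edge. A matching is a set of pairwise disjoint edges, its size is its number of edges, and it is monochromatic if all its edges have the same colour. "With high probability" means with probability tending to $1$ as $n\to\infty$; here the event is that the stated property holds simultaneously for all $q$-colourings of $G$. *)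

theory Defs
  imports "HOL-Probability.Probability" "HOL-Library.Ramsey"
begin

text \<open>
  An \<open>r\<close>-graph is represented by its edge set, a set of \<open>r\<close>-element subsets of the
  vertex set \<open>{..<n}\<close>. The library's \<^term>\<open>nsets V r\<close> is the set of all \<open>r\<close>-element subsets
  of \<open>V\<close>.
\<close>

definition binomial_rgraph :: "nat \<Rightarrow> nat \<Rightarrow> real \<Rightarrow> nat set set pmf" where
  "binomial_rgraph r n p =
     map_pmf (\<lambda>b. {e \<in> nsets {..<n} r. b e})
       (Pi_pmf (nsets {..<n} r) False (\<lambda>_. bernoulli_pmf p))"

definition edge_colouring :: "nat \<Rightarrow> 'a set set \<Rightarrow> ('a set \<Rightarrow> nat) \<Rightarrow> bool" where
  "edge_colouring q E c \<longleftrightarrow> (\<forall>e\<in>E. c e < q)"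

definition is_matching :: "'a set set \<Rightarrow> 'a set set \<Rightarrow> bool" where
  "is_matching E M \<longleftrightarrow> M \<subseteq> E \<and> pairwise disjnt M"

definition monochromatic_edges :: "('a set \<Rightarrow> nat) \<Rightarrow> 'a set set \<Rightarrow> bool" where
  "monochromatic_edges c M \<longleftrightarrow> (\<forall>e\<in>M. \<forall>f\<in>M. c e = c f)"

text \<open>
  \<open>P n\<close> is the property required of the random object with law \<open>G n\<close>.
\<close>

definition whp :: "(nat \<Rightarrow> 'a pmf) \<Rightarrow> (nat \<Rightarrow> 'a \<Rightarrow> bool) \<Rightarrow> bool" where
  "whp G P \<longleftrightarrow> (\<lambda>n. measure_pmf.prob (G n) {x. P n x}) \<longlonglongrightarrow> 1"

end

theory Submission
  imports Defs
begin

text \<open>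
  The random graph enters through a single property: for a constant \<open>\<delta>\<close>, any \<open>r\<close> disjoint vertex
  sets of size \<open>\<lfloor>\<delta> n\<rfloor>\<close> contain an edge with one vertex in each of them. There are at most \<open>2 ^ (r n)\<close>
  such tuples and, for large \<open>n\<close>, each misses all edges with probability at most \<open>exp (- p (\<delta> n / 2) ^ r)\<close>, and
  for \<open>p \<ge> C n ^ (1 - r)\<close> with \<open>C\<close> large the union bound wins (\<open>whp_spans\<close>). The rest of the proof is
  deterministic and works for every sufficiently large graph with this property.

  Call a tuple of disjoint sets robust for a colour if all of its large subtuples contain an edge of
  that colour. Refining any tuple through the colours one after the other, and
  passing to a subtuple without edges of the current colour whenever robustness fails, must stop at
  a robust subtuple, since otherwise a tuple without any edge is reached (\<open>robust_colour\<close>).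

  For one colour, consider the robust tuples with sets of a fixed size \<open>m\<close>. The multiplicative weights
  method gives a robust version of linear programming duality (\<open>matching_or_weights\<close>): either there
  is a matching of about \<open>\<alpha> n\<close> edges, or there are vertex weights \<open>w \<ge> 0\<close> of total \<open>\<alpha> n\<close> under which
  each robust tuple has weight more than \<open>m\<close>. Vertices which have been used often are given
  exponentially larger weight, and one keeps choosing a tuple of weight at most \<open>m\<close>. If this
  never gets stuck, then after boundedly many steps only few vertices are covered much more often
  than a fractional packing of the desired size permits. Because the number of chosen tuples does
  not depend on \<open>n\<close>, this packing can be rounded to disjoint sets, in which robustness lets a
  greedy procedure find the matching.

  If no colour has a large matching, then every colour \<open>i < q\<close> has such weights \<open>w i\<close>, with mean below
  \<open>1 / (r + q - 1)\<close>. Viewing the vertices as points of \<open>q\<close>-dimensional space, some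
  convex combination of at most \<open>q\<close> of the (discretised) points is at most \<open>1 / (r + q - 1)\<close> in
  each coordinate. Multiplying its coefficients by
  \<open>r + q - 1\<close> and rounding down loses less than \<open>q\<close> in total, so that \<open>r\<close> points with multiplicity
  remain, whose sum is at most \<open>1\<close> in each coordinate (\<open>integral_packing\<close>). This is
  where the constant \<open>r + q - 1\<close> comes from. The vertex classes of these points contain a tuple that is
  too light for every colour (\<open>light_tuple\<close>), and yet it has a subtuple that is robust for some colour:
  a contradiction.
\<close>

section \<open>Spanning and robust tuples\<close>

definition spans :: "nat \<Rightarrow> 'a set set \<Rightarrow> (nat \<Rightarrow> 'a set) \<Rightarrow> bool" where
  "spans r H A \<longleftrightarrow> (\<exists>f. (\<forall>j<r. f j \<in> A j) \<and> f ` {..<r} \<in> H)"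

text \<open>
  The threshold \<open>m\<close> is an absolute size and not a proportion of the sets of the tuple. In this
  way robustness passes to subtuples with the same threshold.
\<close>

definition robust :: "nat \<Rightarrow> 'a set set \<Rightarrow> nat \<Rightarrow> (nat \<Rightarrow> 'a set) \<Rightarrow> bool" where
  "robust r H m A \<longleftrightarrow> (\<forall>B. (\<forall>j<r. B j \<subseteq> A j \<and> m \<le> card (B j)) \<longrightarrow> spans r H B)"

text \<open>
  A greedy choice of edges works: each edge uses up one vertex of each \<open>B j\<close>, so
  as long as fewer than \<open>k\<close> edges have been chosen, more than \<open>m\<close> vertices remain in each \<open>B j\<close>.
  That edges are nonempty is recorded so that matchings in disjoint vertex sets are disjoint
  as sets of edges.
\<close>

lemma robust_matching:
  assumes "r > 0" "disjoint_family_on A {..<r}" "robust r H m A"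
    and "\<And>j. j < r \<Longrightarrow> finite (A j)"
    and "\<And>j. j < r \<Longrightarrow> B j \<subseteq> A j" "\<And>j. j < r \<Longrightarrow> m + k \<le> card (B j)"
  shows "\<exists>M. is_matching H M \<and> finite M \<and> card M = k \<and> \<Union>M \<subseteq> (\<Union>j<r. B j) \<and> {} \<notin> M"
  using assms(5,6)
proof (induction k arbitrary: B)
  case 0
  show ?case by (rule exI[of _ "{}"]) (auto simp: is_matching_def)
next
  case (Suc k)
  have "\<forall>j<r. B j \<subseteq> A j \<and> m \<le> card (B j)"
    using Suc.prems by (meson add_leD1)
  then obtain f where f: "\<forall>j<r. f j \<in> B j" "f ` {..<r} \<in> H"
    using assms(3) unfolding robust_def spans_def by blast
  define B' where "B' = (\<lambda>j. B j - {f j})"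
  have "m + k \<le> card (B' j)" if "j < r" for j
    using Suc.prems(2)[OF that] f(1) that by (simp add: B'_def card_Diff_singleton_if)
  moreover have "B' j \<subseteq> A j" if "j < r" for j
    using Suc.prems(1)[OF that] by (auto simp: B'_def)
  ultimately obtain M where M: "is_matching H M" "finite M" "card M = k"
      "\<Union>M \<subseteq> (\<Union>j<r. B' j)" "{} \<notin> M"
    using Suc.IH[of B'] by metis
  have disj: "f ` {..<r} \<inter> (\<Union>j<r. B' j) = {}"
  proof -
    have False if "i < r" "j < r" "f i \<in> B' j" for i j
    proof -
      have "f i \<in> A i" "f i \<in> A j" using that f(1) Suc.prems(1) by (auto simp: B'_def)
      then have "i = j" using assms(2) that by (auto simp: disjoint_family_on_def)
      then show False using that by (simp add: B'_def)
    qed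
    then show ?thesis by blast
  qed
  have ne: "f ` {..<r} \<noteq> {}" using assms(1) by auto
  have notin: "f ` {..<r} \<notin> M" using disj ne M(4) by blast
  have "\<forall>e\<in>M. disjnt (f ` {..<r}) e" using disj M(4) unfolding disjnt_def by blast
  then have "is_matching H (insert (f ` {..<r}) M)"
    using M(1) f(2) by (auto simp: is_matching_def pairwise_insert disjnt_sym)
  moreover have "card (insert (f ` {..<r}) M) = Suc k" using M(2,3) notin by simp
  moreover have "\<Union>(insert (f ` {..<r}) M) \<subseteq> (\<Union>j<r. B j)"
    using M(4) f(1) by (auto simp: B'_def)
  moreover have "{} \<notin> insert (f ` {..<r}) M" using ne M(5) by blast
  ultimately show ?case using M(2) by blast
qed

lemma spans_mono: "spans r H A \<Longrightarrow> (\<And>j. j < r \<Longrightarrow> A j \<subseteq> B j) \<Longrightarrow> spans r H B"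
  unfolding spans_def by blast

text \<open>
  The invariant after \<open>i\<close> rounds is a subtuple with sets of size \<open>m i\<close> and no edge in the colours
  below \<open>i\<close>. If it is not robust for colour \<open>i\<close>, a subtuple witnesses this and starts the next
  round. Surviving all \<open>q\<close> rounds would leave a tuple that contains no edge at all. Every colour
  has its own pair of sizes, which allows the threshold \<open>m (i + 1)\<close> to depend on the size \<open>m i\<close>.
\<close>

lemma robust_colour:
  fixes m :: "nat \<Rightarrow> nat"
  assumes col: "edge_colouring q E c"
    and span: "\<And>B. disjoint_family_on B {..<r} \<Longrightarrow> (\<And>j. j < r \<Longrightarrow> B j \<subseteq> V \<and> card (B j) = m q) \<Longrightarrow> spans r E B"
    and disj: "disjoint_family_on A {..<r}"
    and A: "\<And>j. j < r \<Longrightarrow> A j \<subseteq> V \<and> card (A j) = m 0"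
  shows "\<exists>i<q. \<exists>B. (\<forall>j<r. B j \<subseteq> A j \<and> card (B j) = m i) \<and> robust r {e\<in>E. c e = i} (m (Suc i)) B"
proof (rule ccontr)
  assume neg: "\<not> ?thesis"
  have "\<exists>B. (\<forall>j<r. B j \<subseteq> A j \<and> card (B j) = m i) \<and> \<not> spans r {e\<in>E. c e < i} B" if "i \<le> q" for i
    using that
  proof (induction i)
    case 0
    show ?case using A by (intro exI[of _ A]) (auto simp: spans_def)
  next
    case (Suc i)
    then obtain B where B: "\<forall>j<r. B j \<subseteq> A j \<and> card (B j) = m i" "\<not> spans r {e\<in>E. c e < i} B"
      by auto
    then have "\<not> robust r {e\<in>E. c e = i} (m (Suc i)) B" using neg Suc.prems by (meson Suc_le_lessD)
    then obtain B' where B': "\<forall>j<r. B' j \<subseteq> B j \<and> m (Suc i) \<le> card (B' j)"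
        "\<not> spans r {e\<in>E. c e = i} B'"
      unfolding robust_def by blast
    have "\<exists>X. X \<subseteq> B' j \<and> card X = m (Suc i)" if "j < r" for j
      using B'(1) that by (meson obtain_subset_with_card_n)
    then obtain B'' where B'': "\<And>j. j < r \<Longrightarrow> B'' j \<subseteq> B' j \<and> card (B'' j) = m (Suc i)"
      by metis
    have "\<not> spans r {e\<in>E. c e < Suc i} B''"
    proof
      assume "spans r {e\<in>E. c e < Suc i} B''"
      then have "spans r {e\<in>E. c e < i} B'' \<or> spans r {e\<in>E. c e = i} B''"
        by (auto simp: spans_def less_Suc_eq)
      then have "spans r {e\<in>E. c e < i} B \<or> spans r {e\<in>E. c e = i} B'"
        using B'(1) B'' spans_mono[of r _ B'' B] spans_mono[of r _ B'' B'] by (meson order_trans)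
      then show False using B(2) B'(2) by blast
    qed
    then show ?case using B(1) B'(1) B'' by (intro exI[of _ B'']) (meson order_trans)
  qed
  from this[of q] obtain B where B: "\<forall>j<r. B j \<subseteq> A j \<and> card (B j) = m q" "\<not> spans r {e\<in>E. c e < q} B"
    by auto
  have "{e\<in>E. c e < q} = E" using col by (auto simp: edge_colouring_def)
  moreover have "disjoint_family_on B {..<r}"
  proof -
    have "B i \<inter> B j = {}" if "i < r" "j < r" "i \<noteq> j" for i j
    proof -
      have "B i \<subseteq> A i" "B j \<subseteq> A j" using B(1) that by auto
      moreover have "A i \<inter> A j = {}" using disj that by (auto simp: disjoint_family_on_def)
      ultimately show ?thesis by blast
    qed
    then show ?thesis by (simp add: disjoint_family_on_def)
  qed
  moreover have "B j \<subseteq> V \<and> card (B j) = m q" if "j < r" for j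
  proof
    have "B j \<subseteq> A j" using B(1) that by simp
    also have "A j \<subseteq> V" using A[OF that] by simp
    finally show "B j \<subseteq> V" .
    show "card (B j) = m q" using B(1) that by simp
  qed
  ultimately have "spans r E B" by (intro span)
  then show False using B(2) \<open>{e\<in>E. c e < q} = E\<close> by simp
qed

section \<open>Robust duality by multiplicative weights\<close>

text \<open>
  The potential is the sum of \<open>(1 + \<eta>) ^ x v\<close>, where \<open>x v\<close> is the number of chosen sets that contain
  \<open>v\<close>. Its terms, scaled to total \<open>s\<close>, form a weight function. If some set in \<open>U\<close> has
  weight at most \<open>m\<close>, then adding it to the sequence multiplies the potential by at most
  \<open>1 + \<eta> * m / s\<close>; if no set has, then these weights are as required in the second alternative.
\<close>

lemma light_sequence_or_weights:
  fixes U :: "'a set set" and \<eta> s m :: real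
  assumes "finite V" "V \<noteq> {}" "\<Union>U \<subseteq> V" "\<eta> > 0" "s > 0"
  shows "(\<exists>u. (\<forall>k<T. u k \<in> U) \<and>
            (\<Sum>v\<in>V. (1 + \<eta>) ^ card {k\<in>{..<T}. v \<in> u k}) \<le> card V * (1 + \<eta> * m / s) ^ T)
       \<or> (\<exists>w. (\<forall>v\<in>V. 0 \<le> w v) \<and> (\<Sum>v\<in>V. w v) = s \<and> (\<forall>X\<in>U. m < (\<Sum>v\<in>X. w v)))"
proof (rule disjCI)
  assume no: "\<not> (\<exists>w. (\<forall>v\<in>V. 0 \<le> w v) \<and> (\<Sum>v\<in>V. w v) = s \<and> (\<forall>X\<in>U. m < (\<Sum>v\<in>X. w v)))"
  show "\<exists>u. (\<forall>k<T. u k \<in> U) \<and>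
            (\<Sum>v\<in>V. (1 + \<eta>) ^ card {k\<in>{..<T}. v \<in> u k}) \<le> card V * (1 + \<eta> * m / s) ^ T"
  proof (induction T)
    case 0
    show ?case by simp
  next
    case (Suc T)
    then obtain u where u: "\<forall>k<T. u k \<in> U"
      "(\<Sum>v\<in>V. (1 + \<eta>) ^ card {k\<in>{..<T}. v \<in> u k}) \<le> card V * (1 + \<eta> * m / s) ^ T"
      by blast
    define y where "y v = (1 + \<eta>) ^ card {k\<in>{..<T}. v \<in> u k}" for v
    define \<Phi> where "\<Phi> = (\<Sum>v\<in>V. y v)"
    have y_pos: "y v > 0" for v using assms(4) by (simp add: y_def)
    have \<Phi>_pos: "\<Phi> > 0" unfolding \<Phi>_def using assms(1,2) y_pos by (intro sum_pos) auto
    have "(\<Sum>v\<in>V. s * y v / \<Phi>) = s"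
      using \<Phi>_pos by (simp add: \<Phi>_def flip: sum_distrib_left sum_divide_distrib)
    moreover have "\<forall>v\<in>V. 0 \<le> s * y v / \<Phi>"
      using y_pos \<Phi>_pos assms(5) by (simp add: less_imp_le)
    ultimately obtain X where X: "X \<in> U" "(\<Sum>v\<in>X. s * y v / \<Phi>) \<le> m"
      using no by (meson linorder_not_le)
    have XV: "X \<subseteq> V" using X(1) assms(3) by blast
    have sX: "(\<Sum>v\<in>X. y v) \<le> m * \<Phi> / s"
      using X(2) \<Phi>_pos assms(5)
      by (simp add: field_simps flip: sum_distrib_left sum_divide_distrib)
    define u' where "u' = u(T := X)"
    have step: "(1 + \<eta>) ^ card {k\<in>{..<Suc T}. v \<in> u' k} = y v + (if v \<in> X then \<eta> * y v else 0)" for v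
    proof -
      have "{k\<in>{..<Suc T}. v \<in> u' k} =
          (if v \<in> X then insert T {k\<in>{..<T}. v \<in> u k} else {k\<in>{..<T}. v \<in> u k})"
        by (auto simp: u'_def less_Suc_eq)
      then show ?thesis by (auto simp: y_def algebra_simps)
    qed
    have "(\<Sum>v\<in>V. (1 + \<eta>) ^ card {k\<in>{..<Suc T}. v \<in> u' k}) = \<Phi> + \<eta> * (\<Sum>v\<in>X. y v)"
      unfolding step sum.distrib \<Phi>_def sum_distrib_left
      using XV assms(1) by (simp add: sum.If_cases Int_absorb1)
    also have "\<dots> \<le> \<Phi> + \<eta> * (m * \<Phi> / s)"
      using sX assms(4) by (intro add_left_mono mult_left_mono) auto
    also have "\<dots> = \<Phi> * (1 + \<eta> * m / s)" by (simp add: algebra_simps)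
    also have "\<dots> \<le> card V * (1 + \<eta> * m / s) ^ T * (1 + \<eta> * m / s)"
    proof (rule mult_right_mono)
      have "0 \<le> (\<Sum>v\<in>X. y v)" using y_pos by (simp add: sum_nonneg less_imp_le)
      then have "0 \<le> m * \<Phi> / s" using sX by linarith
      then have "0 \<le> m" using \<Phi>_pos assms(5) by (simp add: zero_le_mult_iff zero_le_divide_iff)
      then show "0 \<le> 1 + \<eta> * m / s" using assms(4,5) by simp
    qed (use u(2) in \<open>simp add: \<Phi>_def y_def\<close>)
    also have "\<dots> = card V * (1 + \<eta> * m / s) ^ Suc T" by simp
    finally have "(\<Sum>v\<in>V. (1 + \<eta>) ^ card {k\<in>{..<Suc T}. v \<in> u' k})
        \<le> card V * (1 + \<eta> * m / s) ^ Suc T" .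
    moreover have "\<forall>k<Suc T. u' k \<in> U" using u(1) X(1) by (auto simp: u'_def less_Suc_eq)
    ultimately show ?case by blast
  qed
qed

text \<open>
  Labels are handed out cyclically within each class of \<open>\<sigma>\<close>.
\<close>

lemma balanced_labelling:
  assumes "finite V" "L > 0"
  shows "\<exists>h::'a \<Rightarrow> nat. \<forall>x. \<forall>a<L. card {v\<in>V. \<sigma> v = x} div L \<le> card {v\<in>V. \<sigma> v = x \<and> h v = a}"
proof -
  have single: "\<exists>h::'a \<Rightarrow> nat. \<forall>a<L. card X div L \<le> card {v\<in>X. h v = a}" if fin: "finite X" for X :: "'a set"
  proof -
    obtain g where g: "bij_betw g X {0..<card X}" using ex_bij_betw_finite_nat[OF fin] by blast
    have "card X div L \<le> card {v\<in>X. g v mod L = a}" if a: "a < L" for a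
    proof -
      have "(\<lambda>b. b * L + a) ` {..<card X div L} \<subseteq> g ` {v\<in>X. g v mod L = a}"
      proof (rule image_subsetI)
        fix b assume "b \<in> {..<card X div L}"
        then have "Suc b \<le> card X div L" by simp
        then have "Suc b * L \<le> card X" using assms(2) by (simp add: less_eq_div_iff_mult_less_eq)
        then have "b * L + a \<in> g ` X" using a g by (simp add: bij_betw_def)
        then obtain v where "v \<in> X" "g v = b * L + a" by (metis imageE)
        then show "b * L + a \<in> g ` {v\<in>X. g v mod L = a}" using a by (metis (mono_tags, lifting)
            image_eqI mem_Collect_eq mod_less mod_mult_self3)
      qed
      then have "card ((\<lambda>b. b * L + a) ` {..<card X div L}) \<le> card (g ` {v\<in>X. g v mod L = a})"
        using fin by (intro card_mono) auto
      also have "\<dots> \<le> card {v\<in>X. g v mod L = a}" using fin by (intro card_image_le) auto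
      finally show ?thesis using assms(2) by (subst (asm) card_image) (auto simp: inj_on_def)
    qed
    then show ?thesis by (intro exI[of _ "\<lambda>v. g v mod L"]) simp
  qed
  then have "\<exists>h::'a \<Rightarrow> nat. \<forall>a<L. card {v\<in>V. \<sigma> v = x} div L \<le> card {v\<in>{v\<in>V. \<sigma> v = x}. h v = a}" for x
    using single[of "{v\<in>V. \<sigma> v = x}"] assms(1) by simp
  then have "\<exists>H. \<forall>x. \<forall>a<L. card {v\<in>V. \<sigma> v = x} div L \<le> card {v\<in>{v\<in>V. \<sigma> v = x}. H x v = a}"
    by (intro choice allI)
  then obtain H where H: "\<forall>x. \<forall>a<L. card {v\<in>V. \<sigma> v = x} div L \<le> card {v\<in>{v\<in>V. \<sigma> v = x}. H x v = a}"
    by (elim exE)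
  have "{v\<in>V. \<sigma> v = x \<and> H (\<sigma> v) v = a} = {v\<in>{v\<in>V. \<sigma> v = x}. H x v = a}" for x and a :: nat
    by auto
  then show ?thesis using H by (intro exI[of _ "\<lambda>v. H (\<sigma> v) v"]) simp
qed

text \<open>
  Rounds a fractional packing in which each set has weight \<open>1 / L\<close>. The vertices are
  classified by the sets \<open>A k j\<close> that contain them. A balanced labelling splits each class into \<open>L\<close>
  parts, and the \<open>a\<close>-th part goes to the \<open>a\<close>-th tuple that covers the class; there are
  enough parts since at most \<open>L\<close> tuples do. Rounding costs at most one vertex per class, which is
  harmless when \<open>T\<close> and \<open>r\<close> are bounded.
\<close>

lemma disjoint_shares:
  fixes A :: "nat \<Rightarrow> nat \<Rightarrow> 'a set"
  assumes fin: "finite W" and L: "L > 0"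
    and load: "\<And>v. v \<in> W \<Longrightarrow> card {k\<in>{..<T}. v \<in> (\<Union>j<r. A k j)} \<le> L"
  shows "\<exists>D. disjoint_family_on D {..<T} \<and>
    (\<forall>k<T. \<forall>j<r. real (card (A k j \<inter> W)) / L - 2 ^ (T * r) \<le> card (A k j \<inter> D k))"
proof -
  define \<sigma> where "\<sigma> v = {(k, j). k < T \<and> j < r \<and> v \<in> A k j}" for v
  have \<sigma>_sub: "\<sigma> v \<in> Pow ({..<T} \<times> {..<r})" for v by (auto simp: \<sigma>_def)
  obtain h :: "'a \<Rightarrow> nat" where h: "\<And>x a. a < L \<Longrightarrow>
      card {v\<in>W. \<sigma> v = x} div L \<le> card {v\<in>W. \<sigma> v = x \<and> h v = a}"
    using balanced_labelling[OF fin L, of \<sigma>] by blast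
  \<comment> \<open>the position of tuple \<open>k\<close> among the tuples that cover the vertices of signature \<open>x\<close>\<close>
  define rk where "rk x k = card {k'. k' < k \<and> (\<exists>j<r. (k', j) \<in> x)}" for x :: "(nat \<times> nat) set" and k
  define D where "D k = {v\<in>W. (\<exists>j<r. v \<in> A k j) \<and> h v = rk (\<sigma> v) k}" for k
  have rk_less: "rk (\<sigma> v) k < rk (\<sigma> v) k'" if "k < k'" "k' < T" "j < r" "v \<in> A k j" for v k k' j
    unfolding rk_def
  proof (rule psubset_card_mono)
    have "k \<in> {k''. k'' < k' \<and> (\<exists>j<r. (k'', j) \<in> \<sigma> v)}" using that by (auto simp: \<sigma>_def)
    then show "{k'. k' < k \<and> (\<exists>j<r. (k', j) \<in> \<sigma> v)} \<subset> {k''. k'' < k' \<and> (\<exists>j<r. (k'', j) \<in> \<sigma> v)}"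
      using that(1) by (intro psubsetI subsetI) auto
  qed simp
  have "disjoint_family_on D {..<T}"
  proof -
    have "D k \<inter> D k' = {}" if "k < k'" "k' < T" for k k'
      using rk_less[OF that] unfolding D_def by (smt (verit) disjoint_iff mem_Collect_eq nat_less_le)
    then show ?thesis unfolding disjoint_family_on_def
      by (metis Int_commute lessThan_iff linorder_neqE_nat)
  qed
  moreover have "real (card (A k j \<inter> W)) / L - 2 ^ (T * r) \<le> card (A k j \<inter> D k)" if kj: "k < T" "j < r" for k j
  proof -
    define X where "X = {x \<in> Pow ({..<T} \<times> {..<r}). (k, j) \<in> x}"
    have finX: "finite X" by (simp add: X_def)
    have "card X \<le> card (Pow ({..<T} \<times> {..<r}))" by (intro card_mono) (auto simp: X_def)
    then have cX: "card X \<le> 2 ^ (T * r)" by (simp add: card_Pow)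
    have share: "real (card {v\<in>W. \<sigma> v = x}) / L - 1 \<le> card {v\<in>W. \<sigma> v = x \<and> h v = rk x k}"
      if x: "x \<in> X" for x
    proof (cases "{v\<in>W. \<sigma> v = x} = {}")
      case True
      show ?thesis unfolding True by simp
    next
      case False
      then obtain v where v: "v \<in> W" "\<sigma> v = x" by blast
      have vA: "v \<in> A k j" using x v by (auto simp: X_def \<sigma>_def)
      have "rk x k < card {k\<in>{..<T}. v \<in> (\<Union>j<r. A k j)}" unfolding rk_def
      proof (rule psubset_card_mono)
        have "{k'. k' < k \<and> (\<exists>j<r. (k', j) \<in> x)} \<subseteq> {k\<in>{..<T}. v \<in> (\<Union>j<r. A k j)} - {k}"
          using v(2) by (auto simp: \<sigma>_def)
        moreover have "k \<in> {k\<in>{..<T}. v \<in> (\<Union>j<r. A k j)}" using kj vA by auto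
        ultimately show "{k'. k' < k \<and> (\<exists>j<r. (k', j) \<in> x)} \<subset> {k\<in>{..<T}. v \<in> (\<Union>j<r. A k j)}" by blast
      qed simp
      then have "rk x k < L" using load[OF v(1)] by linarith
      from h[OF this, of x] have "real (card {v\<in>W. \<sigma> v = x} div L) \<le> card {v\<in>W. \<sigma> v = x \<and> h v = rk x k}"
        by simp
      moreover have "real (card {v\<in>W. \<sigma> v = x}) / L - 1 \<le> real (card {v\<in>W. \<sigma> v = x} div L)"
        using floor_divide_of_nat_eq[of "card {v\<in>W. \<sigma> v = x}" L, where 'a = real] by linarith
      ultimately show ?thesis by linarith
    qed
    have split: "card (A k j \<inter> W \<inter> {v. P v}) = (\<Sum>x\<in>X. card {v\<in>W. \<sigma> v = x \<and> P v})" for P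
    proof -
      have "A k j \<inter> W \<inter> {v. P v} = (\<Union>x\<in>X. {v\<in>W. \<sigma> v = x \<and> P v})"
        using \<sigma>_sub kj by (auto simp: X_def \<sigma>_def)
      moreover have "card (\<Union>x\<in>X. {v\<in>W. \<sigma> v = x \<and> P v}) = (\<Sum>x\<in>X. card {v\<in>W. \<sigma> v = x \<and> P v})"
        using finX fin by (intro card_UN_disjoint) auto
      ultimately show ?thesis by simp
    qed
    have "real (card (A k j \<inter> W)) = (\<Sum>x\<in>X. real (card {v\<in>W. \<sigma> v = x}))"
      using split[of "\<lambda>_. True"] by simp
    then have "real (card (A k j \<inter> W)) / L - 2 ^ (T * r)
        \<le> (\<Sum>x\<in>X. real (card {v\<in>W. \<sigma> v = x}) / L) - card X"
      using cX by (simp add: sum_divide_distrib)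
    also have "\<dots> = (\<Sum>x\<in>X. real (card {v\<in>W. \<sigma> v = x}) / L - 1)" by (simp add: sum_subtractf)
    also have "\<dots> \<le> (\<Sum>x\<in>X. real (card {v\<in>W. \<sigma> v = x \<and> h v = rk x k}))"
      using share by (intro sum_mono) auto
    also have "\<dots> = real (\<Sum>x\<in>X. card {v\<in>W. \<sigma> v = x \<and> h v = rk (\<sigma> v) k})"
    proof -
      have "{v\<in>W. \<sigma> v = x \<and> h v = rk x k} = {v\<in>W. \<sigma> v = x \<and> h v = rk (\<sigma> v) k}" for x by auto
      then show ?thesis by simp
    qed
    also have "\<dots> = card (A k j \<inter> W \<inter> {v. h v = rk (\<sigma> v) k})" by (simp only: split)
    also have "A k j \<inter> W \<inter> {v. h v = rk (\<sigma> v) k} = A k j \<inter> D k" using kj by (auto simp: D_def)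
    finally show ?thesis .
  qed
  ultimately show ?thesis by blast
qed

text \<open>
  Vertices covered more than \<open>L\<close> times are discarded. The remaining vertices are shared out among the
  \<open>T\<close> tuples, and robustness produces a matching inside the share of each tuple.
\<close>

lemma matching_of_robust_tuples:
  assumes r: "r > 0" and L: "L > 0" and finV: "finite V"
    and disj: "\<And>k. k < T \<Longrightarrow> disjoint_family_on (A k) {..<r}"
    and A: "\<And>k j. k < T \<Longrightarrow> j < r \<Longrightarrow> A k j \<subseteq> V \<and> card (A k j) = m"
    and rob: "\<And>k. k < T \<Longrightarrow> robust r H m' (A k)"
    and bad: "real (card {v\<in>V. L < card {k\<in>{..<T}. v \<in> (\<Union>j<r. A k j)}}) \<le> b"
  shows "\<exists>M. is_matching H M \<and> T * ((real m - b) / L - 2 ^ (T * r) - real m' - 1) \<le> card M"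
proof -
  define W where "W = {v\<in>V. card {k\<in>{..<T}. v \<in> (\<Union>j<r. A k j)} \<le> L}"
  have finW: "finite W" using finV by (simp add: W_def)
  have finA: "finite (A k j)" if "k < T" "j < r" for k j
    using A[OF that] finV finite_subset by blast
  obtain D where D: "disjoint_family_on D {..<T}"
      "\<And>k j. k < T \<Longrightarrow> j < r \<Longrightarrow> real (card (A k j \<inter> W)) / L - 2 ^ (T * r) \<le> card (A k j \<inter> D k)"
    using disjoint_shares[where W = W and L = L and T = T and r = r and A = A] finW L unfolding W_def by blast
  define x where "x = (real m - b) / L - 2 ^ (T * r) - real m'"
  have share: "m' + nat \<lfloor>x\<rfloor> \<le> card (A k j \<inter> D k)" if kj: "k < T" "j < r" and x: "0 \<le> x" for k j
  proof -
    have "card (A k j) \<le> card (A k j \<inter> W) + card {v\<in>V. L < card {k\<in>{..<T}. v \<in> (\<Union>j<r. A k j)}}"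
    proof -
      have "A k j \<subseteq> (A k j \<inter> W) \<union> {v\<in>V. L < card {k\<in>{..<T}. v \<in> (\<Union>j<r. A k j)}}"
        using A[OF kj] by (auto simp: W_def)
      then have "card (A k j) \<le> card ((A k j \<inter> W) \<union> {v\<in>V. L < card {k\<in>{..<T}. v \<in> (\<Union>j<r. A k j)}})"
        using finW finV by (intro card_mono) auto
      then show ?thesis using card_Un_le le_trans by blast
    qed
    then have "real (card (A k j)) \<le>
        real (card (A k j \<inter> W)) + real (card {v\<in>V. L < card {k\<in>{..<T}. v \<in> (\<Union>j<r. A k j)}})"
      by linarith
    then have "real m - b \<le> card (A k j \<inter> W)" using A[OF kj] bad by linarith
    then have "(real m - b) / L \<le> real (card (A k j \<inter> W)) / L" by (intro divide_right_mono) auto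
    then have "m' + x \<le> card (A k j \<inter> D k)" using D(2)[OF kj] by (simp add: x_def)
    then show ?thesis using x by linarith
  qed
  have "\<exists>M. is_matching H M \<and> finite M \<and> real (card M) \<ge> x - 1 \<and> \<Union>M \<subseteq> D k \<and> {} \<notin> M" if k: "k < T" for k
  proof (cases "0 \<le> x")
    case True
    have "\<exists>M. is_matching H M \<and> finite M \<and> card M = nat \<lfloor>x\<rfloor> \<and> \<Union>M \<subseteq> (\<Union>j<r. A k j \<inter> D k) \<and> {} \<notin> M"
      by (rule robust_matching[OF r disj[OF k] rob[OF k]]) (use share finA k True in auto)
    moreover have "real (nat \<lfloor>x\<rfloor>) \<ge> x - 1" by linarith
    ultimately show ?thesis by (elim exE conjE) (intro exI conjI; auto)
  next
    case False
    then show ?thesis by (intro exI[of _ "{}"]) (auto simp: is_matching_def)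
  qed
  then have "\<exists>M. \<forall>k. k < T \<longrightarrow> is_matching H (M k) \<and> finite (M k) \<and> real (card (M k)) \<ge> x - 1 \<and>
      \<Union>(M k) \<subseteq> D k \<and> {} \<notin> M k"
    by (intro choice) blast
  then obtain M where M: "\<And>k. k < T \<Longrightarrow> is_matching H (M k)" "\<And>k. k < T \<Longrightarrow> finite (M k)"
      "\<And>k. k < T \<Longrightarrow> real (card (M k)) \<ge> x - 1" "\<And>k. k < T \<Longrightarrow> \<Union>(M k) \<subseteq> D k"
      "\<And>k. k < T \<Longrightarrow> {} \<notin> M k"
    by auto
  have cross: "disjnt e f" if "k < T" "k' < T" "k \<noteq> k'" "e \<in> M k" "f \<in> M k'" for k k' e f
  proof -
    have "e \<subseteq> D k" "f \<subseteq> D k'" using M(4) that by blast+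
    moreover have "D k \<inter> D k' = {}" using D(1) that by (auto simp: disjoint_family_on_def)
    ultimately show ?thesis unfolding disjnt_def by blast
  qed
  have "disjnt e f" if "k < T" "k' < T" "e \<in> M k" "f \<in> M k'" "e \<noteq> f" for k k' e f
    using cross[of k k' e f] M(1)[of k] that by (cases "k = k'") (auto simp: is_matching_def pairwise_def)
  then have "is_matching H (\<Union>k<T. M k)"
    using M(1) unfolding is_matching_def pairwise_def by blast
  moreover have "T * (x - 1) \<le> card (\<Union>k<T. M k)"
  proof -
    have "M k \<inter> M k' = {}" if "k < T" "k' < T" "k \<noteq> k'" for k k'
      using cross[OF that] M(5)[of k] that by (metis disjoint_iff disjnt_self_iff_empty)
    then have "card (\<Union>k<T. M k) = (\<Sum>k<T. card (M k))"
      using M(2) by (intro card_UN_disjoint) auto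
    moreover have "(\<Sum>k<T. x - 1) \<le> (\<Sum>k<T. real (card (M k)))"
      using M(3) by (intro sum_mono) auto
    ultimately show ?thesis by simp
  qed
  ultimately show ?thesis by (auto simp: x_def)
qed

text \<open>
  Suppose the weights do not exist, so that the light sequence can be continued for any number \<open>T\<close> of
  steps. By the potential bound, only few vertices \<open>v\<close> have a covering multiplicity \<open>x v\<close> much
  above \<open>T * m / (\<alpha> * n)\<close>. Taking \<open>L\<close>
  slightly larger than this, each of the \<open>T\<close> tuples contributes nearly \<open>m / L\<close> edges,
  which adds up to nearly \<open>\<alpha> * n\<close>. All parameters except \<open>n\<close> are chosen
  independently of \<open>V\<close>: first \<open>L\<close>, then \<open>T\<close>, and the threshold \<open>\<delta>'\<close> small compared with \<open>\<delta> / L\<close>.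
\<close>

lemma matching_or_weights:
  fixes \<epsilon> \<alpha> \<delta> :: real
  assumes r: "r > 0" and \<epsilon>: "0 < \<epsilon>" "\<epsilon> < 1/2" and \<alpha>: "\<alpha> > 0" and \<delta>: "\<delta> > 0"
  shows "\<exists>\<delta>'::real>0. \<exists>n0. \<forall>(V :: 'a set) H. finite V \<and> n0 \<le> card V \<longrightarrow>
    (\<exists>M. is_matching H M \<and> (1 - 6 * \<epsilon>) * \<alpha> * card V \<le> card M) \<or>
    (\<exists>w. (\<forall>v\<in>V. 0 \<le> w v) \<and> (\<Sum>v\<in>V. w v) = \<alpha> * card V \<and>
      (\<forall>A. disjoint_family_on A {..<r} \<longrightarrow> (\<forall>j<r. A j \<subseteq> V \<and> card (A j) = nat \<lfloor>\<delta> * card V\<rfloor>) \<longrightarrow>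
        robust r H (nat \<lfloor>\<delta>' * card V\<rfloor>) A \<longrightarrow>
        real (nat \<lfloor>\<delta> * card V\<rfloor>) < (\<Sum>v\<in>(\<Union>j<r. A j). w v)))"
proof -
  \<comment> \<open>After all steps a proportion of at most \<open>\<rho> ^ L\<close> of the vertices is covered more than \<open>L\<close> times.\<close>
  define \<rho> where "\<rho> = exp (\<epsilon> * (1 - 2 * \<epsilon>)) / (1 + \<epsilon>)"
  have "\<epsilon> * (1 - 2 * \<epsilon>) < \<epsilon> - \<epsilon>\<^sup>2" using \<epsilon> by (simp add: power2_eq_square algebra_simps)
  also have "\<dots> \<le> ln (1 + \<epsilon>)" using \<epsilon> by (intro ln_one_plus_pos_lower_bound) auto
  finally have "exp (\<epsilon> * (1 - 2 * \<epsilon>)) < exp (ln (1 + \<epsilon>))" by (simp only: exp_less_cancel_iff)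
  then have "exp (\<epsilon> * (1 - 2 * \<epsilon>)) < 1 + \<epsilon>" using \<epsilon> by simp
  then have \<rho>: "0 < \<rho>" "\<rho> < 1" using \<epsilon> by (simp_all add: \<rho>_def)
  have "(\<lambda>L. \<rho> ^ L) \<longlonglongrightarrow> 0" using \<rho> by (intro LIMSEQ_power_zero) auto
  then have "\<forall>\<^sub>F L in sequentially. \<rho> ^ L < \<epsilon> * \<delta>" using \<epsilon> \<delta> by (intro order_tendstoD) auto
  moreover have "\<forall>\<^sub>F L in sequentially. \<delta> / (\<epsilon> * \<alpha>) \<le> real L"
    by (rule eventually_sequentiallyI[of "nat \<lceil>\<delta> / (\<epsilon> * \<alpha>)\<rceil>"]) linarith
  ultimately have "\<forall>\<^sub>F L in sequentially. \<rho> ^ L < \<epsilon> * \<delta> \<and> \<delta> / (\<epsilon> * \<alpha>) \<le> real L \<and> 0 < L"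
    using eventually_gt_at_top[of "0::nat"] by eventually_elim auto
  then obtain L where L: "\<rho> ^ L < \<epsilon> * \<delta>" "\<delta> / (\<epsilon> * \<alpha>) \<le> real L" "0 < L"
    using eventually_happens'[OF sequentially_bot] by blast
  \<comment> \<open>The multiplicity \<open>T * m / (\<alpha> * n)\<close> of the potential bound is then at most, and close to, \<open>(1 - 2 * \<epsilon>) * L\<close>.\<close>
  define T where "T = nat \<lfloor>(1 - 2 * \<epsilon>) * L * \<alpha> / \<delta>\<rfloor>"
  have T_arg: "0 \<le> (1 - 2 * \<epsilon>) * L * \<alpha> / \<delta>" using \<epsilon> \<alpha> \<delta> by simp
  have T_le: "T \<le> (1 - 2 * \<epsilon>) * L * \<alpha> / \<delta>" unfolding T_def using T_arg by linarith
  have "1 \<le> \<epsilon> * L * \<alpha> / \<delta>" using L(2) \<epsilon> \<alpha> \<delta> by (simp add: field_simps)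
  moreover have "(1 - 2 * \<epsilon>) * L * \<alpha> / \<delta> - 1 \<le> T" unfolding T_def using T_arg by linarith
  moreover have "(1 - 3 * \<epsilon>) * L * \<alpha> / \<delta> = (1 - 2 * \<epsilon>) * L * \<alpha> / \<delta> - \<epsilon> * L * \<alpha> / \<delta>"
    using \<delta> by (simp add: field_simps)
  ultimately have T_ge: "(1 - 3 * \<epsilon>) * L * \<alpha> / \<delta> \<le> T" by linarith
  define \<delta>' where "\<delta>' = \<epsilon> * \<delta> / L"
  have \<delta>': "\<delta>' > 0" using \<epsilon> \<delta> L(3) by (simp add: \<delta>'_def)
  \<comment> \<open>\<open>Z\<close> collects all losses that do not grow with \<open>n\<close>.\<close>
  define Z where "Z = T * (2 ^ (T * r) + 2 :: real)"
  define n0 where "n0 = nat \<lceil>Z / (\<epsilon> * \<alpha>)\<rceil> + 1"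
  have main: "\<exists>M. is_matching H M \<and> (1 - 6 * \<epsilon>) * \<alpha> * card V \<le> card M"
    if finV: "finite V" and n0: "n0 \<le> card V"
      and no: "\<not> (\<exists>w. (\<forall>v\<in>V. 0 \<le> w v) \<and> (\<Sum>v\<in>V. w v) = \<alpha> * card V \<and>
      (\<forall>A. disjoint_family_on A {..<r} \<longrightarrow> (\<forall>j<r. A j \<subseteq> V \<and> card (A j) = nat \<lfloor>\<delta> * card V\<rfloor>) \<longrightarrow>
        robust r H (nat \<lfloor>\<delta>' * card V\<rfloor>) A \<longrightarrow>
        real (nat \<lfloor>\<delta> * card V\<rfloor>) < (\<Sum>v\<in>(\<Union>j<r. A j). w v)))"
    for V :: "'a set" and H
  proof -
    define n where "n = real (card V)"
    have n: "n > 0" using n0 by (simp add: n_def n0_def)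
    have nZ: "Z \<le> \<epsilon> * \<alpha> * n"
    proof -
      have "Z / (\<epsilon> * \<alpha>) \<le> n" using n0 unfolding n_def n0_def by linarith
      then show ?thesis using \<epsilon> \<alpha> by (simp add: field_simps)
    qed
    define m where "m = nat \<lfloor>\<delta> * card V\<rfloor>"
    define m' where "m' = nat \<lfloor>\<delta>' * card V\<rfloor>"
    have m: "real m \<le> \<delta> * n" "\<delta> * n - 1 \<le> m" unfolding m_def n_def using \<delta> by (simp, linarith)
    have m': "real m' \<le> \<delta>' * n" unfolding m'_def n_def using \<delta>' by simp
    define \<F> where "\<F> = {A. disjoint_family_on A {..<r} \<and> (\<forall>j<r. A j \<subseteq> V \<and> card (A j) = m) \<and> robust r H m' A}"
    define U where "U = (\<lambda>A. \<Union>j<r. A j) ` \<F>"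
    have "V \<noteq> {}" using n by (auto simp: n_def)
    moreover have "\<Union>U \<subseteq> V" by (auto simp: U_def \<F>_def)
    moreover have "\<alpha> * n > 0" using \<alpha> n by simp
    moreover have "\<not> (\<exists>w. (\<forall>v\<in>V. 0 \<le> w v) \<and> (\<Sum>v\<in>V. w v) = \<alpha> * n \<and> (\<forall>X\<in>U. real m < (\<Sum>v\<in>X. w v)))"
    proof
      assume "\<exists>w. (\<forall>v\<in>V. 0 \<le> w v) \<and> (\<Sum>v\<in>V. w v) = \<alpha> * n \<and> (\<forall>X\<in>U. real m < (\<Sum>v\<in>X. w v))"
      then obtain w where w: "\<forall>v\<in>V. 0 \<le> w v" "(\<Sum>v\<in>V. w v) = \<alpha> * n" "\<forall>X\<in>U. real m < (\<Sum>v\<in>X. w v)"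
        by blast
      show False using no
      proof (rule notE, intro exI[of _ w] conjI allI impI)
        fix A assume "disjoint_family_on A {..<r}" "\<forall>j<r. A j \<subseteq> V \<and> card (A j) = nat \<lfloor>\<delta> * card V\<rfloor>"
          "robust r H (nat \<lfloor>\<delta>' * card V\<rfloor>) A"
        then have "(\<Union>j<r. A j) \<in> U" unfolding U_def \<F>_def m_def m'_def by blast
        then show "real (nat \<lfloor>\<delta> * card V\<rfloor>) < (\<Sum>v\<in>(\<Union>j<r. A j). w v)" using w(3) by (simp add: m_def)
      qed (use w in \<open>simp_all add: n_def\<close>)
    qed
    ultimately obtain u where u: "\<forall>k<T. u k \<in> U"
        "(\<Sum>v\<in>V. (1 + \<epsilon>) ^ card {k\<in>{..<T}. v \<in> u k}) \<le> card V * (1 + \<epsilon> * m / (\<alpha> * n)) ^ T"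
      using light_sequence_or_weights[OF finV, of U \<epsilon> "\<alpha> * n" T "real m"] \<epsilon>(1) by auto
    have "\<exists>A. \<forall>k. k < T \<longrightarrow> A k \<in> \<F> \<and> u k = (\<Union>j<r. A k j)"
      using u(1) by (intro choice) (auto simp: U_def)
    then obtain A where A: "\<And>k. k < T \<Longrightarrow> A k \<in> \<F>" "\<And>k. k < T \<Longrightarrow> u k = (\<Union>j<r. A k j)"
      by auto
    define x where "x v = card {k\<in>{..<T}. v \<in> (\<Union>j<r. A k j)}" for v
    have x_u: "card {k\<in>{..<T}. v \<in> u k} = x v" for v
      unfolding x_def using A(2) by (intro arg_cong[where f = card]) auto
    have "real (card {v\<in>V. L < x v}) * (1 + \<epsilon>) ^ L = (\<Sum>v\<in>{v\<in>V. L < x v}. (1 + \<epsilon>) ^ L)" by simp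
    also have "\<dots> \<le> (\<Sum>v\<in>{v\<in>V. L < x v}. (1 + \<epsilon>) ^ x v)"
      using \<epsilon> by (intro sum_mono power_increasing) auto
    also have "\<dots> \<le> (\<Sum>v\<in>V. (1 + \<epsilon>) ^ x v)"
      using \<epsilon> finV by (intro sum_mono2) auto
    also have "\<dots> \<le> n * (1 + \<epsilon> * m / (\<alpha> * n)) ^ T" using u(2) unfolding x_u n_def .
    also have "\<dots> \<le> n * exp (\<epsilon> * m / (\<alpha> * n)) ^ T"
      using n \<epsilon> \<alpha> exp_ge_add_one_self[of "\<epsilon> * m / (\<alpha> * n)"]
      by (intro mult_left_mono power_mono) auto
    also have "\<dots> = n * exp (T * (\<epsilon> * m / (\<alpha> * n)))" by (simp only: exp_of_nat_mult)
    also have "\<dots> \<le> n * exp (L * (\<epsilon> * (1 - 2 * \<epsilon>)))"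
    proof -
      have "T * (\<epsilon> * m / (\<alpha> * n)) \<le> ((1 - 2 * \<epsilon>) * L * \<alpha> / \<delta>) * (\<epsilon> * (\<delta> * n) / (\<alpha> * n))"
        using T_le m(1) \<epsilon> \<alpha> n T_arg by (intro mult_mono divide_right_mono mult_left_mono) auto
      also have "\<dots> = L * (\<epsilon> * (1 - 2 * \<epsilon>))" using \<alpha> n \<delta> by (simp add: field_simps)
      finally show ?thesis using n by simp
    qed
    also have "\<dots> = n * \<rho> ^ L * (1 + \<epsilon>) ^ L"
      using \<epsilon> by (simp add: \<rho>_def power_divide exp_of_nat_mult)
    finally have "real (card {v\<in>V. L < x v}) \<le> n * \<rho> ^ L" using \<epsilon> by simp
    also have "\<dots> \<le> n * (\<epsilon> * \<delta>)" using n L(1) by (intro mult_left_mono) auto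
    finally have bad: "real (card {v\<in>V. L < x v}) \<le> \<epsilon> * \<delta> * n" by (simp add: mult.commute mult.left_commute)
    have "\<exists>M. is_matching H M \<and> T * ((real m - \<epsilon> * \<delta> * n) / L - 2 ^ (T * r) - real m' - 1) \<le> card M"
      using A(1) bad by (intro matching_of_robust_tuples[OF r L(3) finV]) (auto simp: \<F>_def x_def)
    moreover have "(1 - 6 * \<epsilon>) * \<alpha> * n \<le> T * ((real m - \<epsilon> * \<delta> * n) / L - 2 ^ (T * r) - real m' - 1)"
    proof -
      have "(1 - 6 * \<epsilon>) * \<alpha> * n \<le> (1 - 3 * \<epsilon>) * (1 - 2 * \<epsilon>) * (\<alpha> * n) - \<epsilon> * \<alpha> * n"
        using \<alpha> n \<epsilon> by (simp add: algebra_simps)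
      also have "\<dots> \<le> T * ((1 - 2 * \<epsilon>) * \<delta> * n / L) - Z"
      proof -
        have "(1 - 3 * \<epsilon>) * (1 - 2 * \<epsilon>) * (\<alpha> * n) =
            ((1 - 3 * \<epsilon>) * L * \<alpha> / \<delta>) * ((1 - 2 * \<epsilon>) * \<delta> * n / L)"
          using \<delta> L(3) by (simp add: field_simps)
        also have "\<dots> \<le> T * ((1 - 2 * \<epsilon>) * \<delta> * n / L)"
          using T_ge \<epsilon> \<delta> n by (intro mult_right_mono) auto
        finally show ?thesis using nZ by linarith
      qed
      also have "\<dots> = T * ((1 - 2 * \<epsilon>) * \<delta> * n / L - 2 ^ (T * r) - 2)"
        by (simp add: Z_def algebra_simps)
      also have "\<dots> \<le> T * ((real m - \<epsilon> * \<delta> * n) / L - 2 ^ (T * r) - real m' - 1)"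
      proof (intro mult_left_mono)
        have "(\<delta> * n - 1 - \<epsilon> * \<delta> * n) / L \<le> (real m - \<epsilon> * \<delta> * n) / L"
          using m(2) by (intro divide_right_mono) auto
        moreover have "(1 - 2 * \<epsilon>) * \<delta> * n / L - 1 \<le> (\<delta> * n - 1 - \<epsilon> * \<delta> * n) / L - \<epsilon> * \<delta> / L * n"
        proof -
          have "1 / real L \<le> 1" using L(3) by simp
          moreover have "(\<delta> * n - 1 - \<epsilon> * \<delta> * n) / L - \<epsilon> * \<delta> / L * n = (1 - 2 * \<epsilon>) * \<delta> * n / L - 1 / L"
            using L(3) by (simp add: field_simps)
          ultimately show ?thesis by linarith
        qed
        ultimately show "(1 - 2 * \<epsilon>) * \<delta> * n / L - 2 ^ (T * r) - 2
            \<le> (real m - \<epsilon> * \<delta> * n) / L - 2 ^ (T * r) - real m' - 1"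
          using m' unfolding \<delta>'_def by linarith
      qed simp
      finally show ?thesis .
    qed
    ultimately show ?thesis unfolding n_def by (meson order_trans)
  qed
  show ?thesis
  proof (rule exI[of _ \<delta>'], intro conjI exI[of _ n0] allI impI disjCI)
    show "\<delta>' > 0" by (rule \<delta>')
  qed (rule main; simp)
qed

section \<open>Integral packings of vectors\<close>

text \<open>
  Gaussian elimination: solve the last equation for a variable with nonzero coefficient and
  substitute the result into the others.
\<close>

lemma linear_dependence:
  fixes t :: "'a \<Rightarrow> nat \<Rightarrow> real"
  assumes "finite S" "q < card S"
  shows "\<exists>d. (\<exists>s\<in>S. d s \<noteq> 0) \<and> (\<forall>i<q. (\<Sum>s\<in>S. d s * t s i) = 0)"
  using assms
proof (induction q arbitrary: S t)
  case 0
  then obtain s where "s \<in> S" by (metis card.empty all_not_in_conv less_irrefl)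
  then show ?case by (intro exI[of _ "\<lambda>_. 1"]) auto
next
  case (Suc q)
  show ?case
  proof (cases "\<forall>s\<in>S. t s q = 0")
    case True
    obtain d where d: "\<exists>s\<in>S. d s \<noteq> 0" "\<forall>i<q. (\<Sum>s\<in>S. d s * t s i) = 0"
      using Suc.IH[of S t] Suc.prems by auto
    have "(\<Sum>s\<in>S. d s * t s i) = 0" if "i < Suc q" for i
      using that d(2) True by (cases "i = q") auto
    then show ?thesis using d(1) by blast
  next
    case False
    then obtain z where z: "z \<in> S" "t z q \<noteq> 0" by blast
    define t' where "t' s i = t s i - t s q / t z q * t z i" for s i
    have "q < card (S - {z})" using Suc.prems z(1) by simp
    then obtain d where d: "\<exists>s\<in>S - {z}. d s \<noteq> 0" "\<forall>i<q. (\<Sum>s\<in>S - {z}. d s * t' s i) = 0"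
      using Suc.IH[of "S - {z}" t'] Suc.prems(1) by blast
    define x where "x = - (\<Sum>s\<in>S - {z}. d s * t s q / t z q)"
    define d' where "d' = d(z := x)"
    have split: "(\<Sum>s\<in>S. d' s * t s i) = x * t z i + (\<Sum>s\<in>S - {z}. d s * t s i)" for i
      using sum.remove[OF Suc.prems(1) z(1), of "\<lambda>s. d' s * t s i"] by (simp add: d'_def)
    have "(\<Sum>s\<in>S. d' s * t s i) = (\<Sum>s\<in>S - {z}. d s * t' s i)" for i
      unfolding split t'_def x_def
      by (simp add: sum_subtractf right_diff_distrib sum_distrib_right sum_negf mult.assoc)
    moreover have "t' s q = 0" for s using z(2) by (simp add: t'_def)
    ultimately have "(\<Sum>s\<in>S. d' s * t s i) = 0" if "i < Suc q" for i
      using that d(2) by (cases "i = q") auto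
    moreover have "\<exists>s\<in>S. d' s \<noteq> 0" using d(1) by (auto simp: d'_def)
    ultimately show ?thesis by blast
  qed
qed

text \<open>
  The coefficients \<open>l\<close> are a feasible point of a linear program with \<open>q\<close> constraints, and a
  basic solution has at most \<open>q\<close> nonzero entries. With more than \<open>q\<close> vectors there is a linear
  dependence \<open>d\<close>; moving along \<open>d\<close> keeps all the constraints and, for the right sign of \<open>d\<close>, does not
  decrease the total, until some coefficient becomes zero.
\<close>

lemma sparse_packing:
  fixes t :: "'a \<Rightarrow> nat \<Rightarrow> real" and R :: real
  assumes "finite S" "q > 0" "R > 0"
    and "\<And>s i. s \<in> S \<Longrightarrow> 0 \<le> t s i"
    and "\<And>s. s \<in> S \<Longrightarrow> 0 \<le> l s" "R \<le> sum l S"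
    and "\<And>i. i < q \<Longrightarrow> (\<Sum>s\<in>S. l s * t s i) \<le> 1"
  shows "\<exists>S' l'. S' \<subseteq> S \<and> card S' \<le> q \<and> (\<forall>s\<in>S'. 0 \<le> l' s) \<and> R \<le> sum l' S' \<and>
    (\<forall>i<q. (\<Sum>s\<in>S'. l' s * t s i) \<le> 1)"
  using assms
proof (induction "card S" arbitrary: S l)
  case 0
  then show ?case by auto
next
  case (Suc n)
  show ?case
  proof (cases "card S \<le> q")
    case True
    then show ?thesis using Suc.prems by blast
  next
    case False
    then obtain d0 where d0: "\<exists>s\<in>S. d0 s \<noteq> 0" "\<forall>i<q. (\<Sum>s\<in>S. d0 s * t s i) = 0"
      using linear_dependence[of S q t] Suc.prems(1) by auto
    \<comment> \<open>of the two directions, the one that does not decrease the total\<close>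
    define d where "d = (if sum d0 S \<ge> 0 then d0 else (\<lambda>s. - d0 s))"
    have d: "\<exists>s\<in>S. d s \<noteq> 0" "\<And>i. i < q \<Longrightarrow> (\<Sum>s\<in>S. d s * t s i) = 0" "sum d S \<ge> 0"
      using d0 by (simp_all add: d_def sum_negf)
    show ?thesis
    proof (cases "\<exists>s\<in>S. d s < 0")
      case True
      define N where "N = {s\<in>S. d s < 0}"
      define \<theta> where "\<theta> = Min ((\<lambda>s. l s / - d s) ` N)"
      have N: "finite N" "N \<noteq> {}" using True Suc.prems(1) by (auto simp: N_def)
      have "\<theta> \<in> (\<lambda>s. l s / - d s) ` N" unfolding \<theta>_def using N by (intro Min_in) auto
      then obtain z where z: "z \<in> N" "\<theta> = l z / - d z" by blast
      have \<theta>_le: "\<theta> \<le> l s / - d s" if "s \<in> N" for s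
        unfolding \<theta>_def using N that by (intro Min_le) auto
      have \<theta>_pos: "\<theta> \<ge> 0" using z Suc.prems(5)[of z] by (auto simp: N_def divide_nonneg_neg)
      define l' where "l' s = l s + \<theta> * d s" for s
      have lz: "l' z = 0" using z by (auto simp: l'_def N_def)
      have l'_nonneg: "0 \<le> l' s" if "s \<in> S" for s
      proof (cases "d s < 0")
        case True
        then show ?thesis using \<theta>_le[of s] that by (auto simp: N_def l'_def field_simps)
      next
        case False
        then show ?thesis using \<theta>_pos Suc.prems(5)[OF that] by (simp add: l'_def)
      qed
      have zS: "z \<in> S" using z by (simp add: N_def)
      have rem: "sum g (S - {z}) = sum g S" if "g z = 0" for g :: "'a \<Rightarrow> real"
        using sum.remove[OF Suc.prems(1) zS, of g] that by simp
      have "sum l' S = sum l S + \<theta> * sum d S" by (simp add: l'_def sum.distrib sum_distrib_left)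
      then have s1: "R \<le> sum l' (S - {z})"
        using rem[of l'] lz Suc.prems(6) \<theta>_pos d(3) by (smt (verit) mult_nonneg_nonneg)
      have s2: "(\<Sum>s\<in>S - {z}. l' s * t s i) \<le> 1" if i: "i < q" for i
      proof -
        have "(\<Sum>s\<in>S - {z}. l' s * t s i) = (\<Sum>s\<in>S. l' s * t s i)" using rem lz by simp
        also have "\<dots> = (\<Sum>s\<in>S. l s * t s i) + \<theta> * (\<Sum>s\<in>S. d s * t s i)"
          by (simp add: l'_def algebra_simps sum.distrib sum_distrib_left)
        finally show ?thesis using d(2)[OF i] Suc.prems(7)[OF i] by simp
      qed
      have "\<exists>S' l'. S' \<subseteq> S - {z} \<and> card S' \<le> q \<and> (\<forall>s\<in>S'. 0 \<le> l' s) \<and> R \<le> sum l' S' \<and>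
          (\<forall>i<q. (\<Sum>s\<in>S'. l' s * t s i) \<le> 1)"
        using Suc.prems(1-4) Suc.hyps(2) zS l'_nonneg s1 s2
        by (intro Suc.hyps(1)[of "S - {z}" l']) auto
      then show ?thesis by blast
    next
      case False
      then obtain z where z: "z \<in> S" "d z > 0" using d(1) by force
      \<comment> \<open>A nonnegative dependence exists only among zero vectors, and a zero vector can be used alone.\<close>
      have "t z i = 0" if i: "i < q" for i
      proof -
        have "\<forall>s\<in>S. d s * t s i = 0"
          using d(2)[OF i] False Suc.prems(1,4)
          by (subst (asm) sum_nonneg_eq_0_iff) (auto simp: not_less)
        then show ?thesis using z by auto
      qed
      then show ?thesis using z(1) Suc.prems(2,3)
        by (intro exI[of _ "{z}"] exI[of _ "\<lambda>_. R"]) auto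
    qed
  qed
qed

text \<open>
  Pass to at most \<open>q\<close> coefficients and round them down. Each loses less than one, hence the
  total stays above \<open>(r + q - 1) - q = r - 1\<close> and, being an integer, is at least \<open>r\<close>.
\<close>

lemma integral_packing:
  fixes t :: "'a \<Rightarrow> nat \<Rightarrow> real"
  assumes "finite S" "q > 0" "r > 0"
    and "\<And>s i. s \<in> S \<Longrightarrow> 0 \<le> t s i"
    and "\<And>s. s \<in> S \<Longrightarrow> 0 \<le> l s" "real r + real q - 1 \<le> sum l S"
    and "\<And>i. i < q \<Longrightarrow> (\<Sum>s\<in>S. l s * t s i) \<le> 1"
  shows "\<exists>\<tau>. (\<forall>j<r. \<tau> j \<in> S) \<and> (\<forall>i<q. (\<Sum>j<r. t (\<tau> j) i) \<le> 1)"
proof -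
  have R: "real r + real q - 1 > 0" using assms(2,3) by simp
  have "\<exists>S' l'. S' \<subseteq> S \<and> card S' \<le> q \<and> (\<forall>s\<in>S'. 0 \<le> l' s) \<and> real r + real q - 1 \<le> sum l' S' \<and>
      (\<forall>i<q. (\<Sum>s\<in>S'. l' s * t s i) \<le> 1)"
    by (rule sparse_packing[OF assms(1,2) R assms(4-7)])
  then obtain S' l' where S': "S' \<subseteq> S" "card S' \<le> q" "\<forall>s\<in>S'. 0 \<le> l' s"
      "real r + real q - 1 \<le> sum l' S'" "\<forall>i<q. (\<Sum>s\<in>S'. l' s * t s i) \<le> 1"
    by (elim exE conjE)
  have fin: "finite S'" using S'(1) assms(1) finite_subset by blast
  have ne: "S' \<noteq> {}" using S'(4) R by auto
  define k where "k s = nat \<lfloor>l' s\<rfloor>" for s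
  have k_le: "real (k s) \<le> l' s" if "s \<in> S'" for s using S'(3) that by (simp add: k_def)
  have "real r - 1 \<le> sum l' S' - card S'" using S'(2,4) by simp
  also have "\<dots> = (\<Sum>s\<in>S'. l' s - 1)" by (simp add: sum_subtractf)
  also have "\<dots> < (\<Sum>s\<in>S'. real (k s))"
  proof (rule sum_strict_mono[OF fin ne])
    fix s assume "s \<in> S'"
    then show "l' s - 1 < real (k s)" using S'(3) by (simp add: k_def)
  qed
  finally have "r \<le> card (Sigma S' (\<lambda>s. {..<k s}))"
    using fin by (simp add: card_SigmaI flip: of_nat_sum)
  moreover have finS: "finite (Sigma S' (\<lambda>s. {..<k s}))" using fin by simp
  ultimately obtain f where f: "f ` {..<r} \<subseteq> Sigma S' (\<lambda>s. {..<k s})" "inj_on f {..<r}"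
    using card_le_inj[of "{..<r}" "Sigma S' (\<lambda>s. {..<k s})"] by auto
  have "(\<Sum>j<r. t (fst (f j)) i) \<le> 1" if i: "i < q" for i
  proof -
    have "(\<Sum>j<r. t (fst (f j)) i) = (\<Sum>x\<in>f ` {..<r}. t (fst x) i)"
      using f(2) by (simp add: sum.reindex)
    also have "\<dots> \<le> (\<Sum>x\<in>Sigma S' (\<lambda>s. {..<k s}). t (fst x) i)"
      using f(1) finS S'(1) assms(4) by (intro sum_mono2) auto
    also have "\<dots> = (\<Sum>s\<in>S'. real (k s) * t s i)"
      using sum.Sigma[of S' "\<lambda>s. {..<k s}" "\<lambda>s _. t s i"] fin by (simp add: case_prod_unfold)
    also have "\<dots> \<le> (\<Sum>s\<in>S'. l' s * t s i)"
      using k_le assms(4) S'(1) by (intro sum_mono mult_right_mono) auto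
    finally show ?thesis using S'(5) i by fastforce
  qed
  moreover have "fst (f j) \<in> S" if "j < r" for j using f(1) S'(1) that by fastforce
  ultimately show ?thesis by (intro exI[of _ "\<lambda>j. fst (f j)"]) simp
qed

lemma disjoint_subsets:
  assumes "\<And>j. j < r \<Longrightarrow> finite (X j)" "\<And>j. j < r \<Longrightarrow> r * m \<le> card (X j)"
  shows "\<exists>A. disjoint_family_on A {..<r} \<and> (\<forall>j<r. A j \<subseteq> X j \<and> card (A j) = m)"
proof -
  have "\<exists>A. disjoint_family_on A {..<s} \<and> (\<forall>j<s. A j \<subseteq> X j \<and> card (A j) = m)" if "s \<le> r" for s
    using that
  proof (induction s)
    case 0
    show ?case by (simp add: disjoint_family_on_def)
  next
    case (Suc s)
    then obtain A where A: "disjoint_family_on A {..<s}" "\<forall>j<s. A j \<subseteq> X j \<and> card (A j) = m"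
      by auto
    have "card (\<Union>j<s. A j) \<le> (\<Sum>j<s. card (A j))" by (rule card_UN_le) simp
    also have "\<dots> = s * m" using A(2) by simp
    finally have "card (X s) - s * m \<le> card (X s - (\<Union>j<s. A j))"
      using diff_card_le_card_Diff[of "\<Union>j<s. A j" "X s"] A(2) assms(1) Suc.prems
      by (smt (verit) Suc_le_lessD UN_I diff_le_mono2 finite_UN_I finite_lessThan finite_subset
          lessThan_iff less_trans order_trans)
    moreover have "Suc s * m \<le> card (X s)"
      using assms(2)[of s] Suc.prems by (meson Suc_le_lessD mult_le_mono1 order_trans)
    ultimately have "m \<le> card (X s - (\<Union>j<s. A j))" by simp
    then obtain B where B: "B \<subseteq> X s - (\<Union>j<s. A j)" "card B = m"
      by (meson obtain_subset_with_card_n)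
    have "disjoint_family_on (A(s := B)) {..<Suc s}"
      using A(1) B(1) by (fastforce simp: disjoint_family_on_def less_Suc_eq)
    moreover have "\<forall>j<Suc s. (A(s := B)) j \<subseteq> X j \<and> card ((A(s := B)) j) = m"
      using A(2) B by (auto simp: less_Suc_eq)
    ultimately show ?case by blast
  qed
  then show ?thesis by blast
qed

text \<open>
  Round the weights up to multiples of \<open>1 / K\<close>, which leaves a number \<open>N\<close> of vertex types that is
  independent of \<open>V\<close>. Types with fewer than \<open>r * m\<close> vertices, where \<open>m\<close> is the size of the sets
  wanted, are rare and can be ignored. The others, with coefficients proportional to their
  frequencies, satisfy the hypotheses of \<open>integral_packing\<close>; it selects \<open>r\<close> types, possibly
  with repetitions, and each of them is large enough to supply all \<open>r\<close> sets of the tuple.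
  The weights are bounded by constants on each set, and not just in total, so that the bound
  carries over to every subtuple with sets of equal size.
\<close>

lemma light_tuple:
  fixes \<epsilon> :: real
  assumes r: "r > 0" and q: "q > 0" and \<epsilon>: "0 < \<epsilon>" "\<epsilon> < 1"
  shows "\<exists>\<delta>::real>0. \<forall>(V :: 'a set) w. finite V \<and> V \<noteq> {} \<and>
      (\<forall>i<q. (\<forall>v\<in>V. 0 \<le> w i v) \<and> (\<Sum>v\<in>V. w i v) \<le> (1 - \<epsilon>) / (real r + real q - 1) * card V) \<longrightarrow>
      (\<exists>A t. disjoint_family_on A {..<r} \<and> (\<forall>j<r. A j \<subseteq> V \<and> card (A j) = nat \<lfloor>\<delta> * card V\<rfloor>) \<and>
        (\<forall>i<q. (\<forall>j<r. \<forall>v\<in>A j. w i v \<le> t j i) \<and> (\<Sum>j<r. t j i) \<le> (1 :: real)))"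
proof -
  define R where "R = real r + real q - 1"
  have R: "R > 0" using r q by (simp add: R_def)
  obtain K :: nat where K: "2 * R / \<epsilon> < K" using reals_Archimedean2 by blast
  have K_pos: "K > 0" using K R \<epsilon> by (cases K) (auto simp: field_simps)
  define Ty where "Ty = {..<q} \<rightarrow>\<^sub>E {..K + 1}"
  have finTy: "finite Ty" by (simp add: Ty_def finite_PiE)
  define N where "N = card Ty"
  have N_pos: "N > 0" by (simp add: N_def Ty_def card_PiE)
  define \<delta> where "\<delta> = \<epsilon> / (2 * N * r)"
  have \<delta>: "\<delta> > 0" using \<epsilon> N_pos r by (simp add: \<delta>_def)
  have main: "\<exists>A t. disjoint_family_on A {..<r} \<and> (\<forall>j<r. A j \<subseteq> V \<and> card (A j) = nat \<lfloor>\<delta> * card V\<rfloor>) \<and>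
        (\<forall>i<q. (\<forall>j<r. \<forall>v\<in>A j. w i v \<le> t j i) \<and> (\<Sum>j<r. t j i) \<le> (1 :: real))"
    if fin: "finite V" and ne: "V \<noteq> {}" and w0: "\<And>i v. i < q \<Longrightarrow> v \<in> V \<Longrightarrow> 0 \<le> w i v"
      and ws: "\<And>i. i < q \<Longrightarrow> (\<Sum>v\<in>V. w i v) \<le> (1 - \<epsilon>) / R * card V"
    for V :: "'a set" and w
  proof -
    define n where "n = real (card V)"
    have n: "n > 0" using fin ne by (simp add: n_def card_gt_0_iff)
    define m where "m = nat \<lfloor>\<delta> * card V\<rfloor>"
    have m_le: "real m \<le> \<delta> * n" using \<delta> n by (simp add: m_def n_def)
    \<comment> \<open>Values above \<open>1\<close> are cut off to \<open>(K + 1) / K\<close>, which is too large to occur in a selected type.\<close>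
    define a where "a v = (\<lambda>i\<in>{..<q}. min (K + 1) (nat \<lceil>K * w i v\<rceil>))" for v
    have a_Ty: "a v \<in> Ty" for v by (simp add: a_def Ty_def)
    define X where "X \<tau> = {v\<in>V. a v = \<tau>}" for \<tau>
    have sum_X: "(\<Sum>\<tau>\<in>Ty. \<Sum>v\<in>X \<tau>. g v) = sum g V" for g :: "'a \<Rightarrow> real"
      unfolding X_def using a_Ty by (intro sum.group[OF fin finTy]) auto
    define S where "S = {\<tau>\<in>Ty. r * m \<le> card (X \<tau>)}"
    have finS: "finite S" using finTy by (simp add: S_def)
    define l where "l \<tau> = R * card (X \<tau>) / ((1 - \<epsilon> / 2) * n)" for \<tau>
    have big: "(1 - \<epsilon> / 2) * n \<le> (\<Sum>\<tau>\<in>S. real (card (X \<tau>)))"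
    proof -
      have "(\<Sum>\<tau>\<in>Ty - S. real (card (X \<tau>))) \<le> (\<Sum>\<tau>\<in>Ty - S. r * (\<delta> * n))"
      proof (intro sum_mono)
        fix \<tau> assume "\<tau> \<in> Ty - S"
        then have "card (X \<tau>) \<le> r * m" by (auto simp: S_def)
        then have "real (card (X \<tau>)) \<le> r * real m" by (metis of_nat_le_iff of_nat_mult)
        also have "\<dots> \<le> r * (\<delta> * n)" using m_le by (intro mult_left_mono) auto
        finally show "real (card (X \<tau>)) \<le> r * (\<delta> * n)" .
      qed
      also have "\<dots> \<le> N * (r * (\<delta> * n))"
        using \<delta> n finTy card_mono[of Ty "Ty - S"] by (simp add: N_def mult_right_mono)
      also have "\<dots> = \<epsilon> / 2 * n" using N_pos r by (simp add: \<delta>_def field_simps)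
      finally have "(\<Sum>\<tau>\<in>Ty - S. real (card (X \<tau>))) \<le> \<epsilon> / 2 * n" .
      moreover have "(\<Sum>\<tau>\<in>Ty. real (card (X \<tau>))) = n"
        using sum_X[of "\<lambda>_. 1"] by (simp add: n_def)
      moreover have "(\<Sum>\<tau>\<in>Ty. real (card (X \<tau>))) =
          (\<Sum>\<tau>\<in>Ty - S. real (card (X \<tau>))) + (\<Sum>\<tau>\<in>S. real (card (X \<tau>)))"
        using finTy by (intro sum.subset_diff) (auto simp: S_def)
      ultimately show ?thesis by (simp add: algebra_simps)
    qed
    have pos: "(1 - \<epsilon> / 2) * n > 0" using n \<epsilon> by simp
    have "R \<le> sum l S"
      using big pos R unfolding l_def
      by (simp add: pos_le_divide_eq mult_left_mono flip: sum_divide_distrib sum_distrib_left)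
    moreover have "(\<Sum>\<tau>\<in>S. l \<tau> * (real (\<tau> i) / K)) \<le> 1" if i: "i < q" for i
    proof -
      have "(\<Sum>\<tau>\<in>S. card (X \<tau>) * (real (\<tau> i) / K)) \<le> (\<Sum>\<tau>\<in>Ty. card (X \<tau>) * (real (\<tau> i) / K))"
        using finTy by (intro sum_mono2) (auto simp: S_def)
      also have "\<dots> = (\<Sum>\<tau>\<in>Ty. \<Sum>v\<in>X \<tau>. real (a v i) / K)"
        by (intro sum.cong refl) (simp add: X_def)
      also have "\<dots> = (\<Sum>v\<in>V. real (a v i) / K)" by (rule sum_X)
      also have "\<dots> \<le> (\<Sum>v\<in>V. w i v + 1 / K)"
      proof (intro sum_mono)
        fix v assume "v \<in> V"
        then have "0 \<le> K * w i v" using w0 i by simp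
        then have "real (nat \<lceil>K * w i v\<rceil>) \<le> K * w i v + 1" by linarith
        then have "real (a v i) \<le> K * w i v + 1" using i by (simp add: a_def)
        then show "real (a v i) / K \<le> w i v + 1 / K" using K_pos by (simp add: field_simps)
      qed
      also have "\<dots> \<le> (1 - \<epsilon>) / R * n + n / K"
        using ws[OF i] by (simp add: sum.distrib n_def)
      also have "\<dots> \<le> (1 - \<epsilon>) / R * n + n * \<epsilon> / (2 * R)"
        using K n R \<epsilon> K_pos by (simp add: field_simps)
      also have "\<dots> = (1 - \<epsilon> / 2) * n / R" using R by (simp add: field_simps)
      finally have "(\<Sum>\<tau>\<in>S. card (X \<tau>) * (real (\<tau> i) / K)) \<le> (1 - \<epsilon> / 2) * n / R" .
      moreover have "(\<Sum>\<tau>\<in>S. l \<tau> * (real (\<tau> i) / K)) =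
          R / ((1 - \<epsilon> / 2) * n) * (\<Sum>\<tau>\<in>S. card (X \<tau>) * (real (\<tau> i) / K))"
        by (simp add: l_def sum_distrib_left mult.assoc)
      ultimately show ?thesis using pos R by (simp add: field_simps)
    qed
    moreover have "0 \<le> l s" for s using R pos by (simp add: l_def)
    ultimately obtain \<tau> where \<tau>: "\<forall>j<r. \<tau> j \<in> S" "\<forall>i<q. (\<Sum>j<r. real (\<tau> j i) / K) \<le> 1"
      using integral_packing[OF finS q r, of "\<lambda>\<tau> i. real (\<tau> i) / K" l] unfolding R_def by auto
    obtain A where A: "disjoint_family_on A {..<r}" "\<forall>j<r. A j \<subseteq> X (\<tau> j) \<and> card (A j) = m"
      using disjoint_subsets[of r "\<lambda>j. X (\<tau> j)" m] \<tau>(1) fin by (auto simp: S_def X_def)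
    have "w i v \<le> real (\<tau> j i) / K" if "i < q" "j < r" "v \<in> A j" for i j v
    proof -
      have av: "a v = \<tau> j" using A(2) that by (auto simp: X_def)
      have "real (\<tau> j i) / K \<le> (\<Sum>j<r. real (\<tau> j i) / K)"
        using that(2) by (intro member_le_sum) auto
      also have "\<dots> \<le> 1" using \<tau>(2) that(1) by blast
      finally have "\<tau> j i \<le> K" using K_pos by (simp add: field_simps)
      moreover have "\<tau> j i = min (K + 1) (nat \<lceil>K * w i v\<rceil>)"
        using fun_cong[OF av, of i] that(1) by (simp add: a_def)
      ultimately have "\<tau> j i = nat \<lceil>K * w i v\<rceil>" by simp
      then have "K * w i v \<le> \<tau> j i" by linarith
      then show ?thesis using K_pos by (simp add: field_simps)
    qed
    then show ?thesis using A \<tau>(2)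
      by (intro exI[of _ A] exI[of _ "\<lambda>j i. real (\<tau> j i) / K"]) (auto simp: m_def X_def)
  qed
  show ?thesis
  proof (intro exI[of _ \<delta>] conjI allI impI \<delta>, elim conjE)
    fix V :: "'a set" and w
    assume "finite V" "V \<noteq> {}" "\<forall>i<q. (\<forall>v\<in>V. 0 \<le> w i v) \<and>
      (\<Sum>v\<in>V. w i v) \<le> (1 - \<epsilon>) / (real r + real q - 1) * card V"
    then show "\<exists>A t. disjoint_family_on A {..<r} \<and> (\<forall>j<r. A j \<subseteq> V \<and> card (A j) = nat \<lfloor>\<delta> * card V\<rfloor>) \<and>
        (\<forall>i<q. (\<forall>j<r. \<forall>v\<in>A j. w i v \<le> t j i) \<and> (\<Sum>j<r. t j i) \<le> 1)"
      by (intro main) (simp_all add: R_def)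
  qed
qed

section \<open>Monochromatic matchings from the spanning property\<close>

text \<open>
  The sizes of the tuples form a chain: \<open>d 0\<close> comes from \<open>light_tuple\<close>, and \<open>d (i + 1)\<close> is the
  threshold that \<open>matching_or_weights\<close> provides for colour \<open>i\<close> and tuples of size \<open>d i\<close>. Without a
  large monochromatic matching every colour has its weights. The subtuple that
  \<open>robust_colour\<close> finds in the light tuple is then both heavier and not heavier than \<open>m i\<close> for
  the same colour \<open>i\<close>.
\<close>

lemma monochromatic_matching_of_spanning:
  fixes \<epsilon> :: real
  assumes r: "r > 0" and q: "q > 0" and \<epsilon>: "0 < \<epsilon>" "\<epsilon> < 1/2"
  shows "\<exists>\<delta>::real>0. \<exists>n0. \<forall>(V :: 'a set) E c. finite V \<longrightarrow> n0 \<le> card V \<longrightarrow> edge_colouring q E c \<longrightarrow>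
    (\<forall>A. disjoint_family_on A {..<r} \<and> (\<forall>j<r. A j \<subseteq> V \<and> card (A j) = nat \<lfloor>\<delta> * card V\<rfloor>) \<longrightarrow> spans r E A) \<longrightarrow>
    (\<exists>M. is_matching E M \<and> monochromatic_edges c M \<and>
      (1 - 7 * \<epsilon>) * (card V / (real r + real q - 1)) \<le> card M)"
proof -
  define R where "R = real r + real q - 1"
  have R: "R > 0" using r q by (simp add: R_def)
  define \<alpha> where "\<alpha> = (1 - \<epsilon>) / R"
  have \<alpha>: "\<alpha> > 0" using \<epsilon> R by (simp add: \<alpha>_def)
  define wt where "wt \<delta> \<delta>' V H w \<longleftrightarrow> (\<forall>v\<in>V. 0 \<le> w v) \<and> (\<Sum>v\<in>V. w v) = \<alpha> * card V \<and>
      (\<forall>A. disjoint_family_on A {..<r} \<longrightarrow> (\<forall>j<r. A j \<subseteq> V \<and> card (A j) = nat \<lfloor>\<delta> * card V\<rfloor>) \<longrightarrow>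
        robust r H (nat \<lfloor>\<delta>' * card V\<rfloor>) A \<longrightarrow>
        real (nat \<lfloor>\<delta> * card V\<rfloor>) < (\<Sum>v\<in>(\<Union>j<r. A j). w v))"
    for \<delta> \<delta>' :: real and V :: "'a set" and H w
  define ok where "ok \<delta> \<delta>' n0 \<longleftrightarrow> (\<forall>(V :: 'a set) H. finite V \<and> n0 \<le> card V \<longrightarrow>
      (\<exists>M. is_matching H M \<and> (1 - 6 * \<epsilon>) * \<alpha> * card V \<le> card M) \<or> (\<exists>w. wt \<delta> \<delta>' V H w))"
    for \<delta> \<delta>' :: real and n0 :: nat
  have "\<exists>\<delta>' n0. 0 < \<delta> \<longrightarrow> 0 < \<delta>' \<and> ok \<delta> \<delta>' n0" for \<delta>
    using matching_or_weights[OF r \<epsilon> \<alpha>, of \<delta>, where 'a = 'a] unfolding ok_def wt_def by (cases "0 < \<delta>") auto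
  then obtain nxt N where "\<forall>\<delta>. 0 < \<delta> \<longrightarrow> 0 < nxt \<delta> \<and> ok \<delta> (nxt \<delta>) (N \<delta>)"
    by metis
  then have nxt: "\<And>\<delta>. 0 < \<delta> \<Longrightarrow> 0 < nxt \<delta>" "\<And>\<delta>. 0 < \<delta> \<Longrightarrow> ok \<delta> (nxt \<delta>) (N \<delta>)"
    by simp_all
  obtain \<delta>0 :: real where \<delta>0: "\<delta>0 > 0" and light: "\<And>(V :: 'a set) w. finite V \<and> V \<noteq> {} \<and>
      (\<forall>i<q. (\<forall>v\<in>V. 0 \<le> w i v) \<and> (\<Sum>v\<in>V. w i v) \<le> (1 - \<epsilon>) / (real r + real q - 1) * card V) \<Longrightarrow>
      (\<exists>A t. disjoint_family_on A {..<r} \<and> (\<forall>j<r. A j \<subseteq> V \<and> card (A j) = nat \<lfloor>\<delta>0 * card V\<rfloor>) \<and>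
        (\<forall>i<q. (\<forall>j<r. \<forall>v\<in>A j. w i v \<le> t j i) \<and> (\<Sum>j<r. t j i) \<le> (1 :: real)))"
    using light_tuple[OF r q \<epsilon>(1), where 'a = 'a] \<epsilon>(2) by auto
  define d where "d i = (nxt ^^ i) \<delta>0" for i
  have d_pos: "d i > 0" for i by (induction i) (simp_all add: d_def \<delta>0 nxt(1))
  have d_Suc: "d (Suc i) = nxt (d i)" for i by (simp add: d_def)
  define n0 where "n0 = (\<Sum>i<q. N (d i)) + 1"
  have main: "\<exists>M. is_matching E M \<and> monochromatic_edges c M \<and> (1 - 7 * \<epsilon>) * (card V / R) \<le> card M"
    if fin: "finite V" and n0: "n0 \<le> card V" and col: "edge_colouring q E c"
      and span: "\<And>A. disjoint_family_on A {..<r} \<Longrightarrow>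
        (\<And>j. j < r \<Longrightarrow> A j \<subseteq> V \<and> card (A j) = nat \<lfloor>d q * card V\<rfloor>) \<Longrightarrow> spans r E A"
    for V :: "'a set" and E c
  proof (rule ccontr)
    assume neg: "\<not> (\<exists>M. is_matching E M \<and> monochromatic_edges c M \<and> (1 - 7 * \<epsilon>) * (card V / R) \<le> card M)"
    define H where "H i = {e\<in>E. c e = i}" for i
    define m where "m i = nat \<lfloor>d i * card V\<rfloor>" for i
    have "\<exists>w. wt (d i) (d (Suc i)) V (H i) w" if i: "i < q" for i
    proof (rule ccontr)
      assume no: "\<not> (\<exists>w. wt (d i) (d (Suc i)) V (H i) w)"
      have "N (d i) \<le> (\<Sum>i<q. N (d i))" using i by (intro member_le_sum) auto
      then have "N (d i) \<le> card V" using n0 by (simp add: n0_def)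
      then obtain M where M: "is_matching (H i) M" "(1 - 6 * \<epsilon>) * \<alpha> * card V \<le> card M"
        using nxt(2)[OF d_pos[of i]] no fin unfolding ok_def d_Suc by blast
      have "is_matching E M" "monochromatic_edges c M"
        using M(1) by (auto simp: is_matching_def H_def monochromatic_edges_def)
      moreover have "(1 - 7 * \<epsilon>) * (card V / R) \<le> (1 - 6 * \<epsilon>) * \<alpha> * card V"
      proof -
        have "(1 - 7 * \<epsilon>) * (card V / R) \<le> ((1 - 6 * \<epsilon>) * (1 - \<epsilon>)) * (card V / R)"
          using \<epsilon> R by (intro mult_right_mono) (auto simp: algebra_simps)
        then show ?thesis by (simp add: \<alpha>_def)
      qed
      ultimately show False using neg M(2) by (meson order_trans)
    qed
    then have "\<exists>w. \<forall>i. i < q \<longrightarrow> wt (d i) (d (Suc i)) V (H i) (w i)" by (intro choice) blast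
    then obtain w where w: "\<And>i. i < q \<Longrightarrow> wt (d i) (d (Suc i)) V (H i) (w i)" by auto
    have "V \<noteq> {}" using n0 by (auto simp: n0_def)
    then have "finite V \<and> V \<noteq> {} \<and> (\<forall>i<q. (\<forall>v\<in>V. 0 \<le> w i v) \<and>
        (\<Sum>v\<in>V. w i v) \<le> (1 - \<epsilon>) / (real r + real q - 1) * card V)"
      using fin w unfolding wt_def \<alpha>_def R_def by simp
    from light[OF this] obtain A t where A: "disjoint_family_on A {..<r}"
        "\<forall>j<r. A j \<subseteq> V \<and> card (A j) = nat \<lfloor>\<delta>0 * card V\<rfloor>"
        "\<forall>i<q. (\<forall>j<r. \<forall>v\<in>A j. w i v \<le> t j i) \<and> (\<Sum>j<r. t j i) \<le> 1"
      by (elim exE conjE)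
    have "\<exists>i<q. \<exists>B. (\<forall>j<r. B j \<subseteq> A j \<and> card (B j) = m i) \<and> robust r {e\<in>E. c e = i} (m (Suc i)) B"
    proof (rule robust_colour[OF col _ A(1)])
      show "spans r E B" if "disjoint_family_on B {..<r}" "\<And>j. j < r \<Longrightarrow> B j \<subseteq> V \<and> card (B j) = m q" for B
        using span[OF that(1)] that(2) by (simp add: m_def)
      show "A j \<subseteq> V \<and> card (A j) = m 0" if "j < r" for j
        using A(2) that by (simp add: m_def d_def)
    qed
    then obtain i B where iB: "i < q" "\<forall>j<r. B j \<subseteq> A j \<and> card (B j) = m i" "robust r (H i) (m (Suc i)) B"
      unfolding H_def by (elim exE conjE)
    have BV: "B j \<subseteq> V" "card (B j) = m i" if "j < r" for j
      using iB(2) A(2) that by (metis order_trans)+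
    have disjB: "disjoint_family_on B {..<r}"
    proof -
      have "B j \<inter> B k = {}" if "j < r" "k < r" "j \<noteq> k" for j k
      proof -
        have "B j \<subseteq> A j" "B k \<subseteq> A k" using iB(2) that by auto
        moreover have "A j \<inter> A k = {}" using A(1) that by (auto simp: disjoint_family_on_def)
        ultimately show ?thesis by blast
      qed
      then show ?thesis by (simp add: disjoint_family_on_def)
    qed
    have "real (m i) < (\<Sum>v\<in>(\<Union>j<r. B j). w i v)"
      using w[OF iB(1)] disjB BV iB(3) unfolding wt_def m_def by simp
    also have "\<dots> = (\<Sum>j<r. \<Sum>v\<in>B j. w i v)"
    proof (rule sum.UNION_disjoint)
      show "\<forall>j\<in>{..<r}. finite (B j)" using BV(1) fin finite_subset by blast
    qed (use disjB in \<open>auto simp: disjoint_family_on_def\<close>)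
    also have "\<dots> \<le> (\<Sum>j<r. \<Sum>v\<in>B j. t j i)"
      using A(3) iB(1,2) by (intro sum_mono) blast
    also have "\<dots> = m i * (\<Sum>j<r. t j i)" using BV(2) by (simp add: sum_distrib_left)
    also have "\<dots> \<le> m i" using A(3) iB(1) by (simp add: mult_left_le)
    finally show False by simp
  qed
  show ?thesis
  proof (intro exI[of _ "d q"] exI[of _ n0] conjI allI impI d_pos)
    fix V :: "'a set" and E c
    assume "finite V" "n0 \<le> card V" "edge_colouring q E c"
      "\<forall>A. disjoint_family_on A {..<r} \<and> (\<forall>j<r. A j \<subseteq> V \<and> card (A j) = nat \<lfloor>d q * card V\<rfloor>) \<longrightarrow> spans r E A"
    then show "\<exists>M. is_matching E M \<and> monochromatic_edges c M \<and>
      (1 - 7 * \<epsilon>) * (card V / (real r + real q - 1)) \<le> card M"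
      unfolding R_def[symmetric] by (intro main) simp_all
  qed
qed

section \<open>The spanning property of random graphs\<close>

text \<open>
  As the sets are disjoint, the \<open>m ^ r\<close> choices of one vertex from each of them give distinct
  \<open>r\<close>-sets, all of which must be non-edges.
\<close>

lemma prob_not_spans:
  assumes disj: "disjoint_family_on A {..<r}"
    and A: "\<And>j. j < r \<Longrightarrow> A j \<subseteq> {..<n} \<and> card (A j) = m" and p: "p \<in> {0..1}"
  shows "measure_pmf.prob (binomial_rgraph r n p) {E. \<not> spans r E A} = (1 - p) ^ (m ^ r)"
proof -
  define I where "I = nsets {..<n} r"
  define X where "X = (\<lambda>f. f ` {..<r}) ` (PiE {..<r} A)"
  have finI: "finite I" by (simp add: I_def finite_imp_finite_nsets)
  have same: "i = j" if "i < r" "j < r" "x \<in> A i" "x \<in> A j" for i j x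
    using disj that by (auto simp: disjoint_family_on_def)
  have XI: "X \<subseteq> I"
  proof
    fix e assume "e \<in> X"
    then obtain f where f: "f \<in> PiE {..<r} A" "e = f ` {..<r}" by (auto simp: X_def)
    then have fA: "f j \<in> A j" if "j < r" for j using that by (simp add: PiE_mem)
    have "inj_on f {..<r}"
    proof (rule inj_onI)
      fix i j assume "i \<in> {..<r}" "j \<in> {..<r}" "f i = f j"
      then show "i = j" using same[of i j "f i"] fA[of i] fA[of j] by simp
    qed
    then show "e \<in> I" using f A by (fastforce simp: I_def nsets_def card_image PiE_mem)
  qed
  have "inj_on (\<lambda>f. f ` {..<r}) (PiE {..<r} A)"
  proof (rule inj_onI)
    fix f g assume fg: "f \<in> PiE {..<r} A" "g \<in> PiE {..<r} A" "f ` {..<r} = g ` {..<r}"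
    have "f j = g j" if j: "j < r" for j
    proof -
      have "f j \<in> g ` {..<r}" using fg(3) j by blast
      then obtain i where i: "i < r" "f j = g i" by auto
      have "f j \<in> A j" "g i \<in> A i" using fg(1,2) i(1) j by (auto simp: PiE_mem)
      then have "i = j" using same[of i j "f j"] i j by simp
      then show ?thesis using i by simp
    qed
    then show "f = g" using fg(1,2) by (intro PiE_ext) auto
  qed
  then have cX: "card X = m ^ r" using A by (simp add: X_def card_image card_PiE)
  have spans_iff: "spans r {e\<in>I. b e} A \<longleftrightarrow> (\<exists>e\<in>X. b e)" for b
  proof
    assume "spans r {e\<in>I. b e} A"
    then obtain f where f: "\<forall>j<r. f j \<in> A j" "b (f ` {..<r})" by (auto simp: spans_def)
    have "restrict f {..<r} \<in> PiE {..<r} A" using f(1) by auto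
    moreover have "restrict f {..<r} ` {..<r} = f ` {..<r}" by auto
    ultimately have "f ` {..<r} \<in> X" unfolding X_def by (metis image_eqI)
    then show "\<exists>e\<in>X. b e" using f(2) by blast
  next
    assume "\<exists>e\<in>X. b e"
    then obtain f where "f \<in> PiE {..<r} A" "b (f ` {..<r})" "f ` {..<r} \<in> I" using XI by (auto simp: X_def)
    then show "spans r {e\<in>I. b e} A" by (auto simp: spans_def PiE_mem)
  qed
  define B where "B e = (if e \<in> X then {False} else UNIV)" for e
  have "(\<lambda>b. {e\<in>I. b e}) -` {E. \<not> spans r E A} = Pi I B"
    using XI by (auto simp: spans_iff B_def Pi_def)
  then have "measure_pmf.prob (binomial_rgraph r n p) {E. \<not> spans r E A} =
      measure_pmf.prob (Pi_pmf I False (\<lambda>_. bernoulli_pmf p)) (Pi I B)"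
    by (simp add: binomial_rgraph_def I_def)
  also have "\<dots> = (\<Prod>e\<in>I. measure_pmf.prob (bernoulli_pmf p) (B e))"
    by (rule measure_Pi_pmf_Pi[OF finI])
  also have "\<dots> = (\<Prod>e\<in>I. if e \<in> X then 1 - p else 1)"
    using p by (intro prod.cong refl) (simp add: B_def measure_pmf_single)
  also have "\<dots> = (1 - p) ^ (m ^ r)"
    using finI XI by (simp add: prod.If_cases Int_absorb1 cX)
  finally show ?thesis .
qed

lemma prob_some_not_spans:
  assumes p: "p \<in> {0..1}"
  shows "measure_pmf.prob (binomial_rgraph r n p)
      {E. \<exists>A. disjoint_family_on A {..<r} \<and> (\<forall>j<r. A j \<subseteq> {..<n} \<and> card (A j) = m) \<and> \<not> spans r E A}
    \<le> (2 ^ n) ^ r * (1 - p) ^ (m ^ r)"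
proof -
  let ?P = "measure_pmf.prob (binomial_rgraph r n p)"
  define F where "F = {A \<in> {..<r} \<rightarrow>\<^sub>E Pow {..<n}. disjoint_family_on A {..<r} \<and> (\<forall>j<r. card (A j) = m)}"
  have finF: "finite F" unfolding F_def by (intro finite_subset[OF _ finite_PiE[of "{..<r}" "\<lambda>_. Pow {..<n}"]]) auto
  have "card F \<le> card ({..<r} \<rightarrow>\<^sub>E Pow {..<n})" unfolding F_def by (intro card_mono finite_PiE) auto
  then have cF: "card F \<le> (2 ^ n) ^ r" by (simp add: card_PiE card_Pow)
  have "{E. \<exists>A. disjoint_family_on A {..<r} \<and> (\<forall>j<r. A j \<subseteq> {..<n} \<and> card (A j) = m) \<and> \<not> spans r E A}
      \<subseteq> (\<Union>A\<in>F. {E. \<not> spans r E A})"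
  proof clarify
    fix E A assume A: "disjoint_family_on A {..<r}" "\<forall>j<r. A j \<subseteq> {..<n} \<and> card (A j) = m" "\<not> spans r E A"
    have "restrict A {..<r} \<in> F" using A(1,2) by (auto simp: F_def disjoint_family_on_def)
    moreover have "\<not> spans r E (restrict A {..<r})" using A(3) by (simp add: spans_def)
    ultimately show "E \<in> (\<Union>A\<in>F. {E. \<not> spans r E A})" by blast
  qed
  then have "?P {E. \<exists>A. disjoint_family_on A {..<r} \<and> (\<forall>j<r. A j \<subseteq> {..<n} \<and> card (A j) = m) \<and> \<not> spans r E A}
      \<le> ?P (\<Union>A\<in>F. {E. \<not> spans r E A})"
    by (intro measure_pmf.finite_measure_mono) auto
  also have "\<dots> \<le> (\<Sum>A\<in>F. ?P {E. \<not> spans r E A})"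
    by (intro measure_pmf.finite_measure_subadditive_finite finF) auto
  also have "\<dots> = (\<Sum>A\<in>F. (1 - p) ^ (m ^ r))"
    using p by (intro sum.cong refl prob_not_spans) (auto simp: F_def)
  also have "\<dots> \<le> (2 ^ n) ^ r * (1 - p) ^ (m ^ r)"
    using cF p by (simp add: mult_right_mono) (metis (mono_tags, opaque_lifting) atLeastAtMost_iff diff_ge_0_iff_ge
        mult_right_mono of_nat_le_iff of_nat_numeral of_nat_power zero_le_power)
  finally show ?thesis .
qed

text \<open>
  With \<open>C = (r + 1) * (2 / \<delta>) ^ r\<close> and \<open>m \<ge> \<delta> * n / 2\<close>, the exponent \<open>p * m ^ r\<close> is at least
  \<open>(r + 1) * n\<close>, whereas the number of tuples is at most \<open>exp (r * n)\<close>.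
\<close>

lemma whp_spans:
  fixes \<delta> :: real and p :: "nat \<Rightarrow> real"
  assumes \<delta>: "\<delta> > 0" and p: "\<And>n. p n \<in> {0..1}"
    and p_ge: "\<forall>\<^sub>F n in sequentially. (real r + 1) * (2 / \<delta>) ^ r * real n powr (- real r + 1) \<le> p n"
  shows "whp (\<lambda>n. binomial_rgraph r n (p n))
    (\<lambda>n E. \<forall>A. disjoint_family_on A {..<r} \<and> (\<forall>j<r. A j \<subseteq> {..<n} \<and> card (A j) = nat \<lfloor>\<delta> * n\<rfloor>) \<longrightarrow> spans r E A)"
    (is "whp _ ?Q")
  unfolding whp_def
proof (rule tendsto_sandwich)
  show "(\<lambda>n. 1 - exp (- real n)) \<longlonglongrightarrow> 1"
    by (rule tendsto_eq_intros filterlim_compose[OF exp_at_bot] | simp add: filterlim_uminus_at_bot filterlim_real_sequentially)+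
  show "(\<lambda>_. 1 :: real) \<longlonglongrightarrow> 1" by simp
  show "\<forall>\<^sub>F n in sequentially. measure_pmf.prob (binomial_rgraph r n (p n)) {x. ?Q n x} \<le> 1" by simp
  show "\<forall>\<^sub>F n in sequentially. 1 - exp (- real n) \<le> measure_pmf.prob (binomial_rgraph r n (p n)) {x. ?Q n x}"
    using p_ge eventually_ge_at_top[of "nat \<lceil>2 / \<delta>\<rceil> + 1"]
  proof eventually_elim
    case (elim n)
    define m where "m = nat \<lfloor>\<delta> * n\<rfloor>"
    have n1: "2 / \<delta> \<le> n" and n0: "n > 0" using elim(2) by linarith+
    have "2 \<le> \<delta> * n" using n1 \<delta> by (simp add: field_simps)
    then have m: "\<delta> * n / 2 \<le> m" unfolding m_def by linarith
    have "(real r + 1) * n = (real r + 1) * (2 / \<delta>) ^ r * real n powr (- real r + 1) * (\<delta> * n / 2) ^ r"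
    proof -
      have "(2 / \<delta>) ^ r * (\<delta> * n / 2) ^ r = real n ^ r"
        using \<delta> by (simp flip: power_mult_distrib)
      moreover have "real n powr (- real r + 1) * real n ^ r = n"
        using n0 by (simp add: powr_add[symmetric] flip: powr_realpow)
      ultimately show ?thesis by (metis (no_types, opaque_lifting) mult.assoc mult.commute)
    qed
    also have "\<dots> \<le> p n * m ^ r"
      using elim(1) m p[of n] \<delta> by (intro mult_mono) (auto intro!: power_mono)
    finally have pm: "(real r + 1) * n \<le> p n * real (m ^ r)" by simp
    have "1 - p n \<le> exp (- p n)" using exp_ge_add_one_self[of "- p n"] by simp
    then have "(1 - p n) ^ (m ^ r) \<le> exp (- p n) ^ (m ^ r)" using p[of n] by (intro power_mono) auto
    also have "\<dots> = exp (- (p n * real (m ^ r)))" by (simp add: exp_of_nat_mult[symmetric] mult.commute)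
    also have "\<dots> \<le> exp (- ((real r + 1) * n))" using pm by simp
    finally have e1: "(1 - p n) ^ (m ^ r) \<le> exp (- ((real r + 1) * n))" .
    have "2 \<le> exp (1 :: real)" using exp_ge_add_one_self[of 1] by simp
    then have "((2::real) ^ n) ^ r \<le> (exp 1 ^ n) ^ r" by (intro power_mono) auto
    also have "\<dots> = exp (real r * n)" by (simp add: exp_of_nat_mult[symmetric] power_mult[symmetric] mult.commute)
    finally have e2: "((2::real) ^ n) ^ r \<le> exp (real r * n)" .
    have "(2 ^ n) ^ r * (1 - p n) ^ (m ^ r) \<le> exp (real r * n) * exp (- ((real r + 1) * n))"
      using e1 e2 p[of n] by (intro mult_mono) auto
    also have "\<dots> = exp (- real n)" by (simp add: exp_add[symmetric] algebra_simps)
    finally have bad: "measure_pmf.prob (binomial_rgraph r n (p n)) (- {x. ?Q n x}) \<le> exp (- real n)"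
      using prob_some_not_spans[OF p[of n], of r n m]
      by (simp add: Collect_neg_eq[symmetric] m_def)
    have "measure_pmf.prob (binomial_rgraph r n (p n)) (- {x. ?Q n x}) =
        1 - measure_pmf.prob (binomial_rgraph r n (p n)) {x. ?Q n x}"
      using measure_pmf.prob_compl[of "{x. ?Q n x}"] by (simp add: Compl_eq_Diff_UNIV)
    then show ?case using bad by simp
  qed
qed

section \<open>The random Ramsey theorem for matchings\<close>

lemma whp_mono:
  assumes "whp G P" "\<forall>\<^sub>F n in sequentially. \<forall>x. P n x \<longrightarrow> Q n x"
  shows "whp G Q"
  unfolding whp_def
proof (rule tendsto_sandwich[where h = "\<lambda>_. 1"])
  show "(\<lambda>n. measure_pmf.prob (G n) {x. P n x}) \<longlonglongrightarrow> 1" using assms(1) by (simp add: whp_def)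
  show "\<forall>\<^sub>F n in sequentially. measure_pmf.prob (G n) {x. P n x} \<le> measure_pmf.prob (G n) {x. Q n x}"
    using assms(2) by eventually_elim (auto intro: measure_pmf.finite_measure_mono)
qed simp_all

theorem theorem1p2:
  fixes r q :: nat and \<mu> :: real
  assumes "r \<ge> 2" and "q \<ge> 2" and "\<mu> > 0"
  shows "\<exists>C::real>0. \<forall>p :: nat \<Rightarrow> real.
    (\<forall>n. p n \<in> {0..1}) \<longrightarrow>
    (\<forall>\<^sub>F n in sequentially. p n \<ge> C * real n powr (- real r + 1)) \<longrightarrow>
    whp (\<lambda>n. binomial_rgraph r n (p n))
      (\<lambda>n E. \<forall>c. edge_colouring q E c \<longrightarrow>
        (\<exists>M. is_matching E M \<and> monochromatic_edges c M \<and>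
          real (card M) \<ge> (1 - \<mu>) * (real n / (real r + real q - 1))))"
proof -
  define \<epsilon> where "\<epsilon> = min \<mu> 1 / 7"
  have \<epsilon>: "0 < \<epsilon>" "\<epsilon> < 1/2" and \<epsilon>\<mu>: "1 - \<mu> \<le> 1 - 7 * \<epsilon>" using assms(3) by (auto simp: \<epsilon>_def)
  have r: "r > 0" and q: "q > 0" using assms(1,2) by auto
  obtain \<delta> :: real and n0 where \<delta>: "\<delta> > 0" and
    det: "\<forall>(V :: nat set) E c. finite V \<longrightarrow> n0 \<le> card V \<longrightarrow> edge_colouring q E c \<longrightarrow>
    (\<forall>A. disjoint_family_on A {..<r} \<and> (\<forall>j<r. A j \<subseteq> V \<and> card (A j) = nat \<lfloor>\<delta> * card V\<rfloor>) \<longrightarrow> spans r E A) \<longrightarrow>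
    (\<exists>M. is_matching E M \<and> monochromatic_edges c M \<and>
      (1 - 7 * \<epsilon>) * (card V / (real r + real q - 1)) \<le> card M)"
    using monochromatic_matching_of_spanning[OF r q \<epsilon>, where 'a = nat] by (elim exE conjE)
  show ?thesis
  proof (intro exI[of _ "(real r + 1) * (2 / \<delta>) ^ r"] conjI allI impI)
    show "(real r + 1) * (2 / \<delta>) ^ r > 0" using \<delta> by simp
  next
    fix p :: "nat \<Rightarrow> real"
    assume p: "\<forall>n. p n \<in> {0..1}"
      and p_ge: "\<forall>\<^sub>F n in sequentially. (real r + 1) * (2 / \<delta>) ^ r * real n powr (- real r + 1) \<le> p n"
    show "whp (\<lambda>n. binomial_rgraph r n (p n))
      (\<lambda>n E. \<forall>c. edge_colouring q E c \<longrightarrow>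
        (\<exists>M. is_matching E M \<and> monochromatic_edges c M \<and>
          real (card M) \<ge> (1 - \<mu>) * (real n / (real r + real q - 1))))"
    proof (rule whp_mono[OF whp_spans[OF \<delta> _ p_ge]])
      show "p n \<in> {0..1}" for n using p by blast
      show "\<forall>\<^sub>F n in sequentially. \<forall>E.
         (\<forall>A. disjoint_family_on A {..<r} \<and> (\<forall>j<r. A j \<subseteq> {..<n} \<and> card (A j) = nat \<lfloor>\<delta> * n\<rfloor>) \<longrightarrow> spans r E A) \<longrightarrow>
         (\<forall>c. edge_colouring q E c \<longrightarrow>
        (\<exists>M. is_matching E M \<and> monochromatic_edges c M \<and>
          real (card M) \<ge> (1 - \<mu>) * (real n / (real r + real q - 1))))"
        using eventually_ge_at_top[of n0]
      proof (eventually_elim, intro allI impI)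
        fix n :: nat and E :: "nat set set" and c
        assume n: "n0 \<le> n" and col: "edge_colouring q E c"
          and span: "\<forall>A. disjoint_family_on A {..<r} \<and>
            (\<forall>j<r. A j \<subseteq> {..<n} \<and> card (A j) = nat \<lfloor>\<delta> * n\<rfloor>) \<longrightarrow> spans r E A"
        obtain M where M: "is_matching E M" "monochromatic_edges c M"
            "(1 - 7 * \<epsilon>) * (n / (real r + real q - 1)) \<le> card M"
          using det[rule_format, of "{..<n}" E c] n col span by auto
        have "(1 - \<mu>) * (n / (real r + real q - 1)) \<le> (1 - 7 * \<epsilon>) * (n / (real r + real q - 1))"
          using \<epsilon>\<mu> r q by (intro mult_right_mono) auto
        then show "\<exists>M. is_matching E M \<and> monochromatic_edges c M \<and>
          real (card M) \<ge> (1 - \<mu>) * (real n / (real r + real q - 1))"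
          using M by (intro exI[of _ M]) auto
      qed
    qed
  qed
qed

end
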